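(* Let $\alpha\in(0,1)$, let $f_\alpha$ be the positive $\alpha$-stable density on $(0,\infty)$, and let $h\ge 0$ be a function on $(0,\infty)$ such that $\gamma(t)=h(t)f_\alpha(t)$ is a probability density. Let $V_{n,k}^{\alpha,h}$, $1\le k\le n$, be the coefficients in the EPPF of the exchangeable Gibbs partition arising from the Poisson-Kingman model $PK(\rho_\alpha,h\times f_\alpha)$. Let $s\in(0,\infty)$. Then, for $n\to\infty$ and $k\approx s n^{\alpha}$ (that is, along any integers $k=k_n$ with $1\le k_n\le n$ and $k_n/n^{\alpha}\to s$), $$ V_{n,k}^{\alpha,h}\approx \frac{\alpha^{k-1}\,\Gamma(k)}{\Gamma(n)}\; h\!\left[\left(\frac{k}{n^{\alpha}}\right)^{-1/\alpha}\right], $$ where $\approx$ between the two sides means that their ratio tends to $1$.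
   Context: Stable density: $f_\alpha$ is the density on $(0,\infty)$ with Laplace transform $\int_0^\infty e^{-\lambda t}f_\alpha(t)\,dt=e^{-\lambda^\alpha}$, $\lambda\ge 0$; $\rho_\alpha$ is the Lévy density of the corresponding stable subordinator. Rising factorials: $(x)_n=x(x+1)\cdots(x+n-1)$, $(x)_0=1$. Gibbs partitions: an exchangeable Gibbs partition of $\mathbb{N}$ with parameter $\alpha$ is an infinite exchangeable partition whose exchangeable partition probability function (EPPF), i.e. the probability that the restriction to $\{1,\dots,n\}$ is a given partition with block sizes $(n_1,\dots,n_k)$, has the form $$p(n_1,\dots,n_k)=V_{n,k}\prod_{j=1}^k(1-\alpha)_{n_j-1},$$ with $V_{1,1}=1$ and $V_{n,k}=(n-k\alpha)V_{n+1,k}+V_{n+1,k+1}$. Poisson-Kingman weights: the $PK(\rho_\alpha,h\times f_\alpha)$ model, with mixing density $\gamma(t)=h(t)f_\alpha(t)$, is the Gibbs partition of parameter $\alpha$ whose weights are $$V_{n,k}^{\alpha,h}=\int_0^\infty \frac{\alpha^k}{\Gamma(n-k\alpha)}\,t^{-k\alpha}\left[\int_0^1 p^{\,n-1-k\alpha}f_\alpha((1-p)t)\,dp\right]h(t)\,dt .$$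
   Formalization: h is additionally assumed (Borel) measurable, and continuous and strictly positive at the point s^(-1/α); without this the claim fails, e.g. for h=1 changed to 2 at the countably many points (k_n/n^α)^(-1/α), or is undefined where h vanishes near that point. *)

theory Defs
  imports "HOL-Analysis.Analysis"
begin

definition prob_density_on_pos :: "(real \<Rightarrow> real) \<Rightarrow> bool" where
  "prob_density_on_pos g \<longleftrightarrow>
     set_borel_measurable borel {0<..} g \<and>
     (\<forall>t>0. 0 \<le> g t) \<and>
     set_integrable lborel {0<..} g \<and>
     (LBINT t:{0<..}. g t) = 1"

text \<open>The density of the positive stable law is characterised by its Laplace transform.  It is
  determined only up to a null set, but the weights below do not depend on the chosen version.
  Values outside \<^term>\<open>{0::real<..}\<close> play no role.\<close>

definition stable_density :: "real \<Rightarrow> (real \<Rightarrow> real) \<Rightarrow> bool" where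
  "stable_density \<alpha> f \<longleftrightarrow>
     prob_density_on_pos f \<and>
     (\<forall>l\<ge>0. (LBINT t:{0<..}. exp (- (l * t)) * f t) = exp (- (l powr \<alpha>)))"

text \<open>The weight \<open>V\<^sub>n\<^sub>,\<^sub>k\<close> in the exchangeable partition probability function
  \<open>p(n\<^sub>1, \<dots>, n\<^sub>k) = V\<^sub>n\<^sub>,\<^sub>k \<Prod>\<^sub>j (1 - \<alpha>)\<^sub>n\<^sub>j\<^sub>-\<^sub>1\<close> of the Poisson-Kingman partition driven by the
  stable subordinator, with mixing density \<open>h f\<close>.\<close>

definition PK_weight ::
  "real \<Rightarrow> (real \<Rightarrow> real) \<Rightarrow> (real \<Rightarrow> real) \<Rightarrow> nat \<Rightarrow> nat \<Rightarrow> real" where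
  "PK_weight \<alpha> f h n k =
     (LBINT t:{0<..}.
        \<alpha> ^ k / Gamma (real n - real k * \<alpha>) * t powr (- (real k * \<alpha>)) *
        (LBINT p:{0<..<1}. p powr (real n - 1 - real k * \<alpha>) * f ((1 - p) * t)) *
        h t)"

end

theory Submission
  imports Defs "HOL-Real_Asymp.Real_Asymp"
begin

text \<open>
  After the substitution \<open>u = (1 - p) t\<close> the integrand of \<open>V\<^sub>n\<^sub>,\<^sub>k\<close> is \<open>c\<^sub>n w\<^sub>n(t) h(t)\<close> with
  \<open>c\<^sub>n = \<alpha>\<^sup>k\<^sup>-\<^sup>1 \<Gamma>(k) / \<Gamma>(n)\<close>, where \<open>w\<^sub>n(t)\<close> is a constant times \<open>t\<^sup>-\<^sup>n\<close> times the fractional integral of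
  \<open>f\<close> of order \<open>n - k \<alpha>\<close>.  Writing \<open>t\<^sup>-\<^sup>n\<close> as a Gamma integral shows that \<open>w\<^sub>n\<close> is a probability density.
  As nothing is known about \<open>h\<close> except that \<open>h f\<close> is integrable and \<open>h\<close> is continuous at
  \<open>t\<^sub>0 = s powr (- 1 / \<alpha>)\<close>, the theorem reduces to the estimate \<open>w\<^sub>n \<le> \<delta> f\<close> away from \<open>t\<^sub>0\<close>, for every \<open>\<delta> > 0\<close>
  and all large \<open>n\<close>.

  Uniqueness of Laplace transforms gives \<open>t f(t) = \<alpha> / \<Gamma>(1 - \<alpha>) \<integral>\<^sub>0\<^sup>t (t - u) powr (- \<alpha>) f(u) du\<close>, hence
  a lower bound of \<open>f(t)\<close> by the distribution function, which in turn is bounded through the Laplace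
  transform.  If \<open>t\<close> is not too small, \<open>(1 - u/t) powr m \<le> exp (- m u / t)\<close> bounds \<open>w\<^sub>n\<close> by a Laplace transform
  as well, and the quotient \<open>w\<^sub>n / f\<close> is at most polynomial in \<open>n\<close> times \<open>exp (k (1 + ln y - y))\<close> with
  \<open>y = n powr \<alpha> / (k t powr \<alpha>)\<close>, up to an arbitrarily small loss in the exponent.  For very small \<open>t\<close> the
  powers of \<open>t\<close> are absorbed by iterating the above equation for \<open>f\<close>, that is, by comparing with the
  weight \<open>V\<^sub>k\<^sub>,\<^sub>k\<close>.
\<close>

section \<open>Uniqueness of Laplace transforms\<close>

text \<open>The substitution \<open>x = exp (- t)\<close> turns this into the Hausdorff moment problem on \<open>[0, 1]\<close>.\<close>

lemma finite_measure_eqI_exp_moments: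
  fixes M N :: "real measure"
  assumes sets: "sets M = sets borel" "sets N = sets borel"
    and fin: "finite_measure M" "finite_measure N"
    and pos: "AE t in M. 0 < t" "AE t in N. 0 < t"
    and mom: "\<And>n::nat. (\<integral>t. exp (- t) ^ n \<partial>M) = (\<integral>t. exp (- t) ^ n \<partial>N)"
  shows "M = N"
proof -
  interpret M: finite_measure M by fact
  interpret N: finite_measure N by fact
  have [measurable_cong]: "sets M = sets borel" "sets N = sets borel" by fact+
  \<comment> \<open>The cut-off at 0 puts \<open>b\<close> into the unit interval everywhere, so its
    powers are integrable without any exceptional set; by \<open>pos\<close> it agrees almost
    everywhere with \<open>exp (- t)\<close>.\<close>
  define b :: "real \<Rightarrow> real" where "b t = exp (- max 0 t)" for t
  have [measurable]: "b \<in> borel_measurable borel" unfolding b_def by measurable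
  have b01: "b t \<in> {0..1}" for t by (simp add: b_def)
  have b2: "b t < 2" for t by (rule order_le_less_trans[of _ 1]) (use b01 in auto)
  have bM: "AE t in M. exp (- t) = b t" and bN: "AE t in N. exp (- t) = b t"
    using pos by (auto simp: b_def elim!: eventually_mono)
  have int_bM: "integrable M (\<lambda>t. b t ^ n)" and int_bN: "integrable N (\<lambda>t. b t ^ n)" for n
    by (rule M.integrable_const_bound[of _ 1] N.integrable_const_bound[of _ 1];
        simp add: b_def power_le_one)+
  have pw: "(\<integral>t. b t ^ n \<partial>M) = (\<integral>t. b t ^ n \<partial>N)" for n
  proof -
    have "(\<integral>t. b t ^ n \<partial>M) = (\<integral>t. exp (- t) ^ n \<partial>M)"
      using bM by (intro integral_cong_AE) (auto elim!: eventually_mono)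
    also have "\<dots> = (\<integral>t. b t ^ n \<partial>N)"
      unfolding mom using bN by (intro integral_cong_AE) (auto elim!: eventually_mono)
    finally show ?thesis .
  qed
  have poly: "(\<integral>t. (\<Sum>i\<le>d. c i * b t ^ i) \<partial>M) = (\<integral>t. (\<Sum>i\<le>d. c i * b t ^ i) \<partial>N)"
    for c and d :: nat
    by (simp add: int_bM int_bN pw)
  have poly': "(\<integral>t. poly p (b t) \<partial>M) = (\<integral>t. poly p (b t) \<partial>N)" for p
    unfolding poly_altdef by (rule poly)
  have cont: "(\<integral>t. \<phi> (b t) \<partial>M) = (\<integral>t. \<phi> (b t) \<partial>N)"
    if \<phi>: "continuous_on UNIV \<phi>" for \<phi> :: "real \<Rightarrow> real"
  proof -
    have [measurable]: "\<phi> \<in> borel_measurable borel"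
      using \<phi> by (rule borel_measurable_continuous_onI)
    have "continuous_on {0..1} \<phi>" using \<phi> continuous_on_subset by blast
    note BW = Bernstein_Weierstrass[OF this]
    \<comment> \<open>The Bernstein polynomials of \<open>\<phi>\<close>, written as objects of type
      \<open>poly\<close> so that \<open>poly'\<close> applies to them.\<close>
    define q where "q n = (\<Sum>k\<le>n. smult (\<phi> (k/n) * of_nat (n choose k))
        ([:0, 1:] ^ k * [:1, -1:] ^ (n - k)))" for n :: nat
    have q: "poly (q n) x = (\<Sum>k\<le>n. \<phi> (k/n) * Bernstein n k x)" for n x
      by (simp add: q_def poly_sum Bernstein_def mult.assoc)
    have lim: "(\<lambda>n. poly (q n) (b t)) \<longlonglongrightarrow> \<phi> (b t)" for t
    proof (rule LIMSEQ_I)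
      fix r :: real assume "0 < r"
      from BW[OF this] obtain n0 where
        "\<And>n x. n0 \<le> n \<and> x \<in> {0..1} \<Longrightarrow> \<bar>\<phi> x - (\<Sum>k\<le>n. \<phi> (k/n) * Bernstein n k x)\<bar> < r"
        by blast
      then show "\<exists>n0. \<forall>n\<ge>n0. norm (poly (q n) (b t) - \<phi> (b t)) < r"
        using b01[of t] by (auto simp: q abs_minus_commute intro!: exI[of _ n0])
    qed
    \<comment> \<open>From \<open>n0\<close> on the uniform error is below 1, so the sequence
      shifted by \<open>n0\<close> is dominated by the constant \<open>C + 1\<close>.\<close>
    obtain n0 where n0: "\<And>n x. n0 \<le> n \<Longrightarrow> x \<in> {0..1} \<Longrightarrow> \<bar>\<phi> x - poly (q n) x\<bar> < 1"
      using BW[of 1] unfolding q[symmetric] by auto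
    have "compact (\<phi> ` {0..1})"
      using \<open>continuous_on {0..1} \<phi>\<close> compact_continuous_image by blast
    then obtain C where C: "\<And>x. x \<in> {0..1} \<Longrightarrow> \<bar>\<phi> x\<bar> \<le> C"
      by (metis bounded_real compact_imp_bounded imageI)
    have bd: "\<bar>poly (q (n + n0)) (b t)\<bar> \<le> C + 1" for n t
      using n0[of "n + n0", OF _ b01[of t]] C[OF b01[of t]] by linarith
    have [measurable]: "(\<lambda>t. poly p (b t)) \<in> borel_measurable borel" for p
      unfolding poly_altdef by measurable
    have limM: "(\<lambda>n. \<integral>t. poly (q (n + n0)) (b t) \<partial>M) \<longlonglongrightarrow> (\<integral>t. \<phi> (b t) \<partial>M)"
      by (rule integral_dominated_convergence[where w="\<lambda>_. C + 1"])
         (use bd LIMSEQ_ignore_initial_segment[OF lim] in auto)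
    have limN: "(\<lambda>n. \<integral>t. poly (q (n + n0)) (b t) \<partial>N) \<longlonglongrightarrow> (\<integral>t. \<phi> (b t) \<partial>N)"
      by (rule integral_dominated_convergence[where w="\<lambda>_. C + 1"])
         (use bd LIMSEQ_ignore_initial_segment[OF lim] in auto)
    show ?thesis
      by (rule LIMSEQ_unique[OF limM]) (use limN in \<open>simp add: poly'\<close>)
  qed
  have below: "measure M {t. b t < c} = measure N {t. b t < c}" for c
  proof -
    \<comment> \<open>Continuous ramps that vanish for \<open>x \<ge> c\<close> and tend to 1 for
      \<open>x < c\<close>: their limit is the indicator of the open half-line at every point,
      \<open>c\<close> included.\<close>
    define \<phi> where "\<phi> n x = max 0 (min 1 (real n * (c - x)))" for n :: nat and x
    have \<phi>: "continuous_on UNIV (\<phi> n)" for n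
      unfolding \<phi>_def by (intro continuous_intros)
    have [measurable]: "\<phi> n \<in> borel_measurable borel" for n
      using \<phi> by (rule borel_measurable_continuous_onI)
    have lim: "(\<lambda>n. \<phi> n x) \<longlonglongrightarrow> indicat_real {..<c} x" for x
    proof (cases "x < c")
      case True
      have "eventually (\<lambda>n. real n * (c - x) \<ge> 1) sequentially"
        using True by real_asymp
      then have "eventually (\<lambda>n. \<phi> n x = 1) sequentially"
        by eventually_elim (simp add: \<phi>_def)
      then show ?thesis using True by (simp add: tendsto_eventually)
    next
      case False
      then have "real n * (c - x) \<le> 0" for n by (simp add: mult_nonneg_nonpos)
      then have "\<phi> n x = 0" for n by (simp add: \<phi>_def min.coboundedI2)
      then show ?thesis using False by simp
    qed
    have limM: "(\<lambda>n. \<integral>t. \<phi> n (b t) \<partial>M) \<longlonglongrightarrow> (\<integral>t. indicator {..<c} (b t) \<partial>M)"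
      by (rule integral_dominated_convergence[where w="\<lambda>_. 1"])
         (use lim in \<open>auto simp: \<phi>_def\<close>)
    have limN: "(\<lambda>n. \<integral>t. \<phi> n (b t) \<partial>N) \<longlonglongrightarrow> (\<integral>t. indicator {..<c} (b t) \<partial>N)"
      by (rule integral_dominated_convergence[where w="\<lambda>_. 1"])
         (use lim in \<open>auto simp: \<phi>_def\<close>)
    have "(\<integral>t. indicator {..<c} (b t) \<partial>M) = (\<integral>t. indicat_real {..<c} (b t) \<partial>N)"
      by (rule LIMSEQ_unique[OF limM]) (use limN in \<open>simp add: cont[OF \<phi>]\<close>)
    moreover have "indicat_real {..<c} (b t) = indicator {t. b t < c} t" for t
      by (simp add: indicator_def)
    moreover have "{t. b t < c} \<in> sets borel" by measurable
    ultimately show ?thesis by (simp add: sets sets_eq_imp_space_eq[OF sets(1)] sets_eq_imp_space_eq[OF sets(2)])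
  qed
  have tail: "measure M {x<..} = measure N {x<..}" for x :: real
  proof (cases "0 \<le> x")
    case True
    then have "{t. b t < exp (- x)} = {x<..}" by (auto simp: b_def)
    then show ?thesis using below[of "exp (- x)"] by simp
  next
    case False
    \<comment> \<open>For negative \<open>x\<close> both sets carry the full mass: the first by
      \<open>pos\<close>, the second because \<open>b\<close> never exceeds 1.\<close>
    have "measure M {x<..} = measure M {t. b t < 2}"
      using pos(1) False b2
      by (intro measure_eq_AE) (auto elim!: eventually_mono simp: sets)
    moreover have "measure N {x<..} = measure N {t. b t < 2}"
      using pos(2) False b2
      by (intro measure_eq_AE) (auto elim!: eventually_mono simp: sets)
    ultimately show ?thesis by (simp add: below)
  qed
  show ?thesis
    by (rule measure_eqI_lessThan) (use sets tail in \<open>simp_all add: M.emeasure_eq_measure N.emeasure_eq_measure\<close>)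
qed

text \<open>The weight \<open>exp (- t)\<close> turns \<open>g1\<close> and \<open>g2\<close> into
  densities of finite measures, and the transform at \<open>l = n + 1\<close> is the
  \<open>n\<close>-th moment of \<open>exp (- t)\<close> under these measures.\<close>

lemma laplace_transform_unique:
  fixes g1 g2 :: "real \<Rightarrow> ennreal"
  assumes [measurable]: "g1 \<in> borel_measurable borel" "g2 \<in> borel_measurable borel"
    and supp: "\<And>t. t \<le> 0 \<Longrightarrow> g1 t = 0" "\<And>t. t \<le> 0 \<Longrightarrow> g2 t = 0"
    and fin: "\<And>l. 0 < l \<Longrightarrow> (\<integral>\<^sup>+t. ennreal (exp (- (l * t))) * g1 t \<partial>lborel) < \<infinity>"
    and eq: "\<And>l. 0 < l \<Longrightarrow> (\<integral>\<^sup>+t. ennreal (exp (- (l * t))) * g1 t \<partial>lborel)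
                = (\<integral>\<^sup>+t. ennreal (exp (- (l * t))) * g2 t \<partial>lborel)"
  shows "AE t in lborel. g1 t = g2 t"
proof -
  define D where "D g = density lborel (\<lambda>t. ennreal (exp (- t)) * g t)" for g
  have ee: "exp (- (t::real)) * exp (- t) ^ n = exp (- ((real n + 1) * t))" for t and n :: nat
    by (simp add: ring_distribs exp_add [symmetric] flip: exp_of_nat_mult)
  have ee': "ennreal (exp (- t)) * g t * ennreal (exp (- t) ^ n)
      = ennreal (exp (- ((real n + 1) * t))) * g t" for t g and n :: nat
    unfolding ee[symmetric] by (simp add: ennreal_mult mult_ac)
  have nn: "(\<integral>\<^sup>+t. ennreal (exp (- t) ^ n) \<partial>D g)
      = (\<integral>\<^sup>+t. ennreal (exp (- ((real n + 1) * t))) * g t \<partial>lborel)"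
    if [measurable]: "g \<in> borel_measurable borel" for g n
    unfolding D_def
    by (subst nn_integral_density)
       (simp_all only: ee', measurable)
  have LI: "(\<integral>t. exp (- t) ^ n \<partial>D g) = enn2real (\<integral>\<^sup>+t. ennreal (exp (- t) ^ n) \<partial>D g)" for g n
    by (rule integral_eq_nn_integral) (auto simp: D_def)
  have fM: "finite_measure (D g)"
    if [measurable]: "g \<in> borel_measurable borel"
      and "(\<integral>\<^sup>+t. ennreal (exp (- (1 * t))) * g t \<partial>lborel) < \<infinity>" for g
    using that(2) by (intro finite_measureI) (simp add: D_def emeasure_density)
  have f1: "finite_measure (D g1)" using fin[of 1] by (intro fM) simp_all
  have f2: "finite_measure (D g2)" using fin[of 1] eq[of 1] by (intro fM) simp_all
  have "D g1 = D g2"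
  proof (rule finite_measure_eqI_exp_moments)
    have supp': "0 < t" if "0 < ennreal (exp (- t)) * g t" "\<And>t. t \<le> 0 \<Longrightarrow> g t = 0"
      for t and g :: "real \<Rightarrow> ennreal"
      using that by (cases "t \<le> 0") auto
    show "AE t in D g1. 0 < t" "AE t in D g2. 0 < t"
      unfolding D_def by (simp_all add: AE_density supp' supp)
    fix n :: nat
    show "(\<integral>t. exp (- t) ^ n \<partial>D g1) = (\<integral>t. exp (- t) ^ n \<partial>D g2)"
      using eq[of "real n + 1"] by (simp add: LI nn)
  qed (use f1 f2 in \<open>simp_all add: D_def\<close>)
  moreover have "sigma_finite_measure (D g1)"
    using f1 by (simp add: finite_measure_def)
  ultimately have "AE t in lborel. ennreal (exp (- t)) * g1 t = ennreal (exp (- t)) * g2 t"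
    unfolding D_def by (subst (asm) sigma_finite_density_unique) auto
  then show ?thesis by eventually_elim (simp add: ennreal_mult_cancel_left)
qed

section \<open>Euler integrals\<close>

lemma nn_integral_Gamma_real:
  assumes "0 < b" "0 < (x::real)"
  shows "(\<integral>\<^sup>+t. ennreal (t powr (b - 1) * exp (- (x * t))) * indicator {0<..} t \<partial>lborel)
      = ennreal (Gamma b * x powr (- b))"
proof -
  have "ennreal (Gamma b) = (\<integral>\<^sup>+t. ennreal (t powr (b - 1) * exp (- t)) * indicator {0<..} t \<partial>lborel)"
    unfolding Gamma_conv_nn_integral_real[OF assms(1)]
    by (intro nn_integral_cong) (auto simp: indicator_def exp_minus field_simps)
  also have "\<dots> = ennreal x *
      (\<integral>\<^sup>+t. ennreal ((x * t) powr (b - 1) * exp (- (x * t))) * indicator {0<..} (x * t) \<partial>lborel)"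
    using assms by (subst nn_integral_real_affine[where c=x and t=0]) auto
  also have "\<dots> = ennreal (x powr b) *
      (\<integral>\<^sup>+t. ennreal (t powr (b - 1) * exp (- (x * t))) * indicator {0<..} t \<partial>lborel)"
  proof -
    have "(x * t) powr (b - 1) * exp (- (x * t)) = x powr (b - 1) * (t powr (b - 1) * exp (- (x * t)))"
      if "0 < t" for t
      using assms that by (simp add: powr_mult)
    then have "(\<integral>\<^sup>+t. ennreal ((x * t) powr (b - 1) * exp (- (x * t))) * indicator {0<..} (x * t) \<partial>lborel)
      = (\<integral>\<^sup>+t. ennreal (x powr (b - 1)) *
          (ennreal (t powr (b - 1) * exp (- (x * t))) * indicator {0<..} t) \<partial>lborel)"
      using assms by (intro nn_integral_cong)
        (auto simp: indicator_def zero_less_mult_iff ennreal_mult mult.assoc)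
    also have "\<dots> = ennreal (x powr (b - 1)) *
          (\<integral>\<^sup>+t. ennreal (t powr (b - 1) * exp (- (x * t))) * indicator {0<..} t \<partial>lborel)"
      by (rule nn_integral_cmult) measurable
    finally show ?thesis
      using assms by (simp add: powr_diff mult.assoc[symmetric] flip: ennreal_mult)
  qed
  finally have "ennreal (x powr (- b)) * ennreal (Gamma b) = ennreal (x powr (- b)) * (ennreal (x powr b) *
      (\<integral>\<^sup>+t. ennreal (t powr (b - 1) * exp (- (x * t))) * indicator {0<..} t \<partial>lborel))"
    by simp
  then show ?thesis
    using assms by (simp add: mult.assoc[symmetric] flip: ennreal_mult powr_add) (simp add: mult.commute)
qed

lemma nn_integral_Beta_real:
  assumes "0 < b" "0 < c" "v < (t::real)"
  shows "(\<integral>\<^sup>+u. ennreal ((t - u) powr (b - 1) * (u - v) powr (c - 1)) * indicator {v<..<t} u \<partial>lborel)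
      = ennreal (Beta b c * (t - v) powr (b + c - 1))"
proof -
  define d where "d = t - v"
  have d: "0 < d" using assms by (simp add: d_def)
  have "(\<integral>\<^sup>+u. ennreal ((t - u) powr (b - 1) * (u - v) powr (c - 1)) * indicator {v<..<t} u \<partial>lborel)
      = ennreal d * (\<integral>\<^sup>+x. ennreal ((t - (v + d * x)) powr (b - 1) * (v + d * x - v) powr (c - 1))
          * indicator {v<..<t} (v + d * x) \<partial>lborel)"
    using d by (subst nn_integral_real_affine[where c=d and t=v]) auto
  also have "(\<integral>\<^sup>+x. ennreal ((t - (v + d * x)) powr (b - 1) * (v + d * x - v) powr (c - 1))
          * indicator {v<..<t} (v + d * x) \<partial>lborel)
     = (\<integral>\<^sup>+x. ennreal (d powr (b - 1) * d powr (c - 1)) *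
        (ennreal (x powr (c - 1) * (1 - x) powr (b - 1)) * indicator {0..1} x) \<partial>lborel)"
  proof (intro nn_integral_cong)
    fix x :: real
    have i: "indicator {v<..<t} (v + d * x) = (indicator {0<..<1} x :: ennreal)"
    proof -
      have "v + d * x < t \<longleftrightarrow> d * x < d * 1" by (auto simp: d_def)
      also have "\<dots> \<longleftrightarrow> x < 1" using d by (subst mult_less_cancel_left_pos) auto
      finally show ?thesis using d by (auto simp: indicator_def zero_less_mult_iff)
    qed
    show "ennreal ((t - (v + d * x)) powr (b - 1) * (v + d * x - v) powr (c - 1))
          * indicator {v<..<t} (v + d * x) = ennreal (d powr (b - 1) * d powr (c - 1)) *
        (ennreal (x powr (c - 1) * (1 - x) powr (b - 1)) * indicator {0..1} x)"
    proof (cases "0 < x \<and> x < 1")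
      case True
      have "t - (v + d * x) = d * (1 - x)" by (simp add: d_def algebra_simps)
      then show ?thesis
        unfolding i using True d by (simp add: powr_mult mult_ac flip: ennreal_mult)
    next
      case False
      \<comment> \<open>At the endpoints 0 and 1 one factor is \<open>0 powr _ = 0\<close>, so the
        open and the closed interval give the same integrand.\<close>
      then have "x powr (c - 1) * (1 - x) powr (b - 1) = 0 \<or> x \<notin> {0..1}" by force
      then show ?thesis unfolding i using False by (auto simp: indicator_def)
    qed
  qed
  also have "\<dots> = ennreal (d powr (b - 1) * d powr (c - 1)) * ennreal (Beta c b)"
    using nn_integral_has_integral_lebesgue'[OF _ has_integral_Beta_real[of c b]] assms
    by (subst nn_integral_cmult) auto
  also have "ennreal d * \<dots> = ennreal (Beta b c * d powr (b + c - 1))"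
  proof -
    have "d * (d powr (b - 1) * d powr (c - 1)) = d powr (b + c - 1)"
      using d by (simp add: powr_diff powr_add)
    then show ?thesis
      using d by (simp add: Beta_commute mult.assoc[symmetric] flip: ennreal_mult) (simp add: mult_ac ennreal_mult'')
  qed
  finally show ?thesis by (simp add: d_def)
qed

text \<open>The Gamma integral under the substitution \<open>y = x powr a\<close>.\<close>

lemma nn_integral_powr_exp_powr:
  assumes "0 < a" "0 < b"
  shows "(\<integral>\<^sup>+x. ennreal (x powr (a * b - 1) * exp (- (x powr a))) * indicator {0<..} x \<partial>lborel)
      = ennreal (Gamma b / a)"
proof -
  define F where "F y = y powr (b - 1) / exp y" for y :: real
  have "(F has_integral Gamma b) {0..}"
    unfolding F_def by (rule Gamma_integral_real[OF assms(2)])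
  then have F: "(F has_integral Gamma b) {0<..}"
    by (rule has_integral_spike_set_eq[THEN iffD1, rotated 2]) (auto intro: negligible_subset[of "{0}"])
  have "F absolutely_integrable_on {0<..}"
    using F by (intro nonnegative_absolutely_integrable_1) (auto simp: F_def)
  moreover have im: "(\<lambda>x. x powr a) ` {0<..} = {0<..}"
  proof (safe)
    fix y :: real assume "0 < y"
    then have "y = (y powr (1 / a)) powr a" "0 < y powr (1 / a)"
      using assms by (simp_all add: powr_powr)
    then show "y \<in> (\<lambda>x. x powr a) ` {0<..}" by blast
  qed (use assms in auto)
  moreover have "inj_on (\<lambda>x. x powr a) {0<..}"
    by (rule inj_onI)
       (metis assms(1) greaterThan_iff less_imp_le less_irrefl linorder_less_linear powr_less_mono2)
  ultimately have "(\<lambda>x. \<bar>a * x powr (a - 1)\<bar> * F (x powr a)) absolutely_integrable_on {0<..} \<and>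
      integral {0<..} (\<lambda>x. \<bar>a * x powr (a - 1)\<bar> * F (x powr a)) = Gamma b"
    using F
    by (subst has_absolute_integral_change_of_variables_1')
       (auto simp: integral_unique intro!: derivative_eq_intros)
  then have "((\<lambda>x. \<bar>a * x powr (a - 1)\<bar> * F (x powr a)) has_integral Gamma b) {0<..}"
    by (metis has_integral_integrable_integral set_lebesgue_integral_eq_integral(1))
  then have "((\<lambda>x. a * (x powr (a * b - 1) * exp (- (x powr a)))) has_integral Gamma b) {0<..}"
  proof (rule has_integral_eq[rotated])
    fix x :: real assume "x \<in> {0<..}"
    then have "x powr (a - 1) * (x powr a) powr (b - 1) = x powr (a * b - 1)"
      by (simp add: powr_powr algebra_simps flip: powr_add)
    then show "\<bar>a * x powr (a - 1)\<bar> * F (x powr a) = a * (x powr (a * b - 1) * exp (- (x powr a)))"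
      using assms by (simp add: F_def abs_mult exp_minus field_simps)
  qed
  then have "((\<lambda>x. x powr (a * b - 1) * exp (- (x powr a))) has_integral Gamma b / a) {0<..}"
    using assms by (subst (asm) has_integral_mult_right_iff) auto
  from nn_integral_has_integral_lebesgue'[OF _ this] show ?thesis by simp
qed

section \<open>Fractional integrals of the stable density\<close>

text \<open>A version of the stable density that is measurable and nonnegative on the whole line and
  vanishes off the positive half-line, so that set integrals become plain integrals and convolutions
  can be handled by Fubini for nonnegative functions.\<close>

locale stable_law =
  fixes a :: real and f :: "real \<Rightarrow> real"
  assumes a: "0 < a" "a < 1"
    and f_meas [measurable]: "f \<in> borel_measurable borel"
    and f_nonneg: "0 \<le> f t"
    and f_supp: "t \<le> 0 \<Longrightarrow> f t = 0"
    and laplace: "0 \<le> l \<Longrightarrow>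
      (\<integral>\<^sup>+t. ennreal (exp (- (l * t)) * f t) \<partial>lborel) = ennreal (exp (- (l powr a)))"
begin

text \<open>This is \<open>\<Gamma>(b)\<close> times the Riemann-Liouville integral of order \<open>b\<close>.  The indicator is essential, as
  \<open>powr\<close> does not vanish on negative bases.\<close>

definition frac_int :: "real \<Rightarrow> real \<Rightarrow> ennreal" where
  "frac_int b t = (\<integral>\<^sup>+u. ennreal ((t - u) powr (b - 1) * f u) * indicator {..<t} u \<partial>lborel)"

lemma frac_int_measurable [measurable]: "frac_int b \<in> borel_measurable borel"
  unfolding frac_int_def lessThan_def by measurable

lemma frac_int_nonpos: "t \<le> 0 \<Longrightarrow> frac_int b t = 0"
proof -
  assume "t \<le> 0"
  then have "frac_int b t = (\<integral>\<^sup>+u. 0 \<partial>(lborel :: real measure))"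
    unfolding frac_int_def by (intro nn_integral_cong) (auto simp: indicator_def f_supp)
  then show ?thesis by simp
qed

section \<open>Laplace transforms and the integral equation of the stable density\<close>

lemma total_mass: "(\<integral>\<^sup>+t. ennreal (f t) \<partial>lborel) = 1"
  using laplace[of 0] by simp

text \<open>\<open>frac_int b\<close> is the convolution of \<open>f\<close> with
  \<open>s powr (b - 1)\<close> on the positive half-line, so its transform is the product of a
  Gamma integral and the transform of \<open>f\<close>.\<close>

lemma laplace_frac_int:
  assumes "0 < b" "0 < x"
  shows "(\<integral>\<^sup>+t. ennreal (exp (- (x * t))) * frac_int b t \<partial>lborel)
      = ennreal (Gamma b * x powr (- b) * exp (- (x powr a)))"
proof -
  define H where "H t u = ennreal (exp (- (x * t)) * (t - u) powr (b - 1) * f u) * indicator {u<..} t"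
    for t u :: real
  have H_meas [measurable]: "case_prod H \<in> borel_measurable (lborel \<Otimes>\<^sub>M lborel)"
    unfolding H_def greaterThan_def by measurable
  have "(\<integral>\<^sup>+t. ennreal (exp (- (x * t))) * frac_int b t \<partial>lborel)
      = (\<integral>\<^sup>+t. (\<integral>\<^sup>+u. H t u \<partial>lborel) \<partial>lborel)"
    unfolding frac_int_def
    by (subst nn_integral_cmult [symmetric])
       (auto intro!: nn_integral_cong simp: H_def indicator_def ennreal_mult f_nonneg mult.assoc lessThan_def)
  also have "\<dots> = (\<integral>\<^sup>+u. (\<integral>\<^sup>+t. H t u \<partial>lborel) \<partial>lborel)"
    using lborel_pair.Fubini'[of H] by simp
  also have "\<dots> = (\<integral>\<^sup>+u. ennreal (Gamma b * x powr (- b)) * ennreal (exp (- (x * u)) * f u) \<partial>lborel)"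
  proof (intro nn_integral_cong)
    fix u :: real
    have "(\<integral>\<^sup>+t. H t u \<partial>lborel) = (\<integral>\<^sup>+s. H (u + 1 * s) u \<partial>lborel)"
      by (subst nn_integral_real_affine[where c=1 and t=u]) (auto simp: H_def)
    also have "\<dots> = (\<integral>\<^sup>+s. ennreal (exp (- (x * u)) * f u) *
        (ennreal (s powr (b - 1) * exp (- (x * s))) * indicator {0<..} s) \<partial>lborel)"
      by (intro nn_integral_cong)
         (auto simp: H_def indicator_def f_nonneg ring_distribs exp_add exp_diff exp_minus field_simps
           simp flip: ennreal_mult)
    also have "\<dots> = ennreal (exp (- (x * u)) * f u) * ennreal (Gamma b * x powr (- b))"
      by (subst nn_integral_cmult) (auto simp: nn_integral_Gamma_real[OF assms])
    finally show "(\<integral>\<^sup>+t. H t u \<partial>lborel) = ennreal (Gamma b * x powr (- b)) * ennreal (exp (- (x * u)) * f u)"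
      by (simp add: mult.commute)
  qed
  also have "\<dots> = ennreal (Gamma b * x powr (- b)) * ennreal (exp (- (x powr a)))"
    using laplace[of x] assms by (subst nn_integral_cmult) auto
  also have "\<dots> = ennreal (Gamma b * x powr (- b) * exp (- (x powr a)))"
    using assms by (simp flip: ennreal_mult)
  finally show ?thesis .
qed

text \<open>Differentiation of \<open>exp (- (l powr a))\<close> under the integral sign, by
  dominated convergence of the difference quotients with increments
  \<open>e n = 1 / (n + 1)\<close>.\<close>

lemma laplace_first_moment:
  assumes "0 < l"
  shows "(\<integral>\<^sup>+t. ennreal (exp (- (l * t))) * ennreal (t * f t) \<partial>lborel)
      = ennreal (a * l powr (a - 1) * exp (- (l powr a)))"
proof -
  have intg: "integrable lborel (\<lambda>t. exp (- (x * t)) * f t)"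
    and int: "(\<integral>t. exp (- (x * t)) * f t \<partial>lborel) = exp (- (x powr a))" if "0 \<le> x" for x
  proof -
    show "integrable lborel (\<lambda>t. exp (- (x * t)) * f t)"
      using laplace[OF that] by (intro integrableI_nonneg) (auto simp: f_nonneg)
    show "(\<integral>t. exp (- (x * t)) * f t \<partial>lborel) = exp (- (x powr a))"
      using laplace[OF that] by (subst integral_eq_nn_integral) (auto simp: f_nonneg)
  qed
  have f_int: "integrable lborel f" using intg[of 0] by simp
  define e where "e n = 1 / (real n + 1)" for n
  have e: "0 < e n" for n by (simp add: e_def)
  define g where "g n t = (exp (- (l * t)) - exp (- ((l + e n) * t))) / e n * f t" for n t
  have g_int: "(\<integral>t. g n t \<partial>lborel) = (exp (- (l powr a)) - exp (- ((l + e n) powr a))) / e n" for n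
  proof -
    have "(\<integral>t. g n t \<partial>lborel)
       = (\<integral>t. (exp (- (l * t)) * f t - exp (- ((l + e n) * t)) * f t) / e n \<partial>lborel)"
      by (intro Bochner_Integration.integral_cong) (simp_all add: g_def left_diff_distrib)
    also have "\<dots> = (exp (- (l powr a)) - exp (- ((l + e n) powr a))) / e n"
      using assms e[of n] intg int by simp
    finally show ?thesis .
  qed
  have bound: "\<bar>g n t\<bar> \<le> f t / l" for n t
  proof (cases "t \<le> 0")
    case True
    then show ?thesis by (simp add: g_def f_supp)
  next
    case False
    have "exp (- (l * t)) - exp (- ((l + e n) * t)) = exp (- (l * t)) * (1 - exp (- (e n * t)))"
      by (simp add: ring_distribs exp_diff exp_minus exp_add field_simps)
    moreover have "1 - exp (- (e n * t)) \<le> e n * t"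
      using exp_ge_add_one_self[of "- (e n * t)"] by simp
    moreover have "0 \<le> 1 - exp (- (e n * t))" using False e[of n] by simp
    ultimately have "0 \<le> exp (- (l * t)) - exp (- ((l + e n) * t))"
      and "exp (- (l * t)) - exp (- ((l + e n) * t)) \<le> exp (- (l * t)) * (e n * t)"
      by (simp_all only: mult_nonneg_nonneg exp_ge_zero mult_left_mono)
    then have 1: "0 \<le> (exp (- (l * t)) - exp (- ((l + e n) * t))) / e n"
      and 2: "(exp (- (l * t)) - exp (- ((l + e n) * t))) / e n \<le> exp (- (l * t)) * t"
      using e[of n] by (simp_all add: pos_divide_le_eq mult_ac)
    \<comment> \<open>This bounds \<open>t * exp (- (l * t))\<close> by \<open>1 / l\<close>, which
      makes \<open>f / l\<close> an integrable majorant of all the difference quotients.\<close>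
    have "l * t \<le> exp (l * t)" using exp_ge_add_one_self[of "l * t"] by linarith
    then have "exp (- (l * t)) * t \<le> 1 / l"
      using assms by (simp add: exp_minus field_simps)
    with 1 2 have "\<bar>(exp (- (l * t)) - exp (- ((l + e n) * t))) / e n\<bar> \<le> 1 / l" by linarith
    from mult_right_mono[OF this f_nonneg[of t]] show ?thesis
      by (simp add: g_def abs_mult f_nonneg)
  qed
  have lim: "(\<lambda>n. g n t) \<longlonglongrightarrow> exp (- (l * t)) * (t * f t)" for t
  proof -
    have "(\<lambda>n. (exp (- (l * t)) - exp (- ((l + e n) * t))) / e n) \<longlonglongrightarrow> exp (- (l * t)) * t"
      unfolding e_def by real_asymp
    from tendsto_mult[OF this tendsto_const[of "f t"]] show ?thesis
      by (simp add: g_def mult.assoc)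
  qed
  have [measurable]: "g n \<in> borel_measurable lborel" for n
    unfolding g_def by measurable
  have dom: "integrable lborel (\<lambda>t. exp (- (l * t)) * (t * f t))"
       "(\<lambda>n. \<integral>t. g n t \<partial>lborel) \<longlonglongrightarrow> (\<integral>t. exp (- (l * t)) * (t * f t) \<partial>lborel)"
    by (rule integrable_dominated_convergence[where w="\<lambda>t. f t / l" and s=g]
             integral_dominated_convergence[where w="\<lambda>t. f t / l"];
        use lim bound f_int in simp)+
  have "(\<lambda>n. \<integral>t. g n t \<partial>lborel) \<longlonglongrightarrow> exp (- (l powr a)) * (l powr a * (inverse l * a))"
    unfolding g_int e_def using assms a by real_asymp
  also have "exp (- (l powr a)) * (l powr a * (inverse l * a)) = a * l powr (a - 1) * exp (- (l powr a))"
    using assms by (simp add: powr_diff field_simps)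
  finally have "(\<integral>t. exp (- (l * t)) * (t * f t) \<partial>lborel) = a * l powr (a - 1) * exp (- (l powr a))"
    using dom(2) LIMSEQ_unique by blast
  moreover have "0 \<le> exp (- (l * t)) * (t * f t)" for t
    using f_nonneg[of t] f_supp[of t] by (cases "t \<le> 0") auto
  ultimately have "(\<integral>\<^sup>+t. ennreal (exp (- (l * t)) * (t * f t)) \<partial>lborel)
      = ennreal (a * l powr (a - 1) * exp (- (l powr a)))"
    using nn_integral_eq_integral[OF dom(1)] by simp
  then show ?thesis by (simp add: ennreal_mult')
qed

text \<open>Both sides have the transform \<open>a * l powr (a - 1) * exp (- (l powr a))\<close>.
  The equation is one between versions of a density, hence the almost-everywhere form.\<close>

lemma stable_density_equation:
  "AE t in lborel. ennreal (t * f t) = ennreal (a / Gamma (1 - a)) * frac_int (1 - a) t"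
proof (rule laplace_transform_unique)
  fix l :: real assume l: "0 < l"
  have G: "0 < Gamma (1 - a)" using a by (intro Gamma_real_pos) simp
  have "(\<integral>\<^sup>+t. ennreal (exp (- (l * t))) * (ennreal (a / Gamma (1 - a)) * frac_int (1 - a) t) \<partial>lborel)
      = ennreal (a / Gamma (1 - a)) * (\<integral>\<^sup>+t. ennreal (exp (- (l * t))) * frac_int (1 - a) t \<partial>lborel)"
    by (subst nn_integral_cmult [symmetric]) (auto intro!: nn_integral_cong simp: mult_ac)
  also have "\<dots> = ennreal (a * l powr (a - 1) * exp (- (l powr a)))"
    using a l G by (simp add: laplace_frac_int less_imp_neq[OF G, symmetric] flip: ennreal_mult)
  finally show "(\<integral>\<^sup>+t. ennreal (exp (- (l * t))) * ennreal (t * f t) \<partial>lborel)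
      = (\<integral>\<^sup>+t. ennreal (exp (- (l * t))) * (ennreal (a / Gamma (1 - a)) * frac_int (1 - a) t) \<partial>lborel)"
    by (simp only: laplace_first_moment[OF l])
qed (auto simp: f_supp frac_int_nonpos laplace_first_moment)

text \<open>Bound \<open>u f(u)\<close> by \<open>t f(u)\<close> inside the fractional integral and use the semigroup property.\<close>

lemma frac_int_step:
  assumes "0 < b"
  shows "ennreal (a * Gamma b / Gamma (b + (1 - a))) * frac_int (b + (1 - a)) t \<le> ennreal t * frac_int b t"
proof -
  \<comment> \<open>The double integrand that arises when the equation for \<open>u * f u\<close> is
    inserted into a fractional integral of order \<open>b\<close>; integrating out \<open>u\<close>
    leaves a Beta integral.\<close>
  define H where "H u v = ennreal ((t - u) powr (b - 1) * (u - v) powr ((1 - a) - 1) * f v) * indicator {v<..<t} u"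
    for u v :: real
  have H_meas [measurable]: "case_prod H \<in> borel_measurable (lborel \<Otimes>\<^sub>M lborel)"
    unfolding H_def greaterThanLessThan_eq lessThan_def greaterThan_def by measurable
  have "(\<integral>\<^sup>+u. ennreal (t * ((t - u) powr (b - 1) * f u)) * indicator {..<t} u \<partial>lborel)
     \<ge> (\<integral>\<^sup>+u. ennreal ((t - u) powr (b - 1)) * indicator {..<t} u * ennreal (u * f u) \<partial>lborel)"
    by (intro nn_integral_mono)
       (auto simp: indicator_def f_nonneg mult_mono mult.left_commute intro!: ennreal_leI mult_left_mono mult_right_mono simp flip: ennreal_mult')
  also have "(\<integral>\<^sup>+u. ennreal (t * ((t - u) powr (b - 1) * f u)) * indicator {..<t} u \<partial>lborel)
      = ennreal t * frac_int b t"
    unfolding frac_int_def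
    by (subst nn_integral_cmult [symmetric])
       (auto intro!: nn_integral_cong simp: f_nonneg ennreal_mult'' mult.assoc)
  \<comment> \<open>Under the integral sign an equation that holds almost everywhere is enough, so
    the final inequality holds for every \<open>t\<close>.\<close>
  also have "(\<integral>\<^sup>+u. ennreal ((t - u) powr (b - 1)) * indicator {..<t} u * ennreal (u * f u) \<partial>lborel)
      = (\<integral>\<^sup>+u. ennreal (a / Gamma (1 - a)) * (\<integral>\<^sup>+v. H u v \<partial>lborel) \<partial>lborel)"
  proof (rule nn_integral_cong_AE)
    have inner: "ennreal ((t - u) powr (b - 1)) * indicator {..<t} u * frac_int (1 - a) u = (\<integral>\<^sup>+v. H u v \<partial>lborel)" for u
    proof (cases "u < t")
      case True
      have "ennreal ((t - u) powr (b - 1)) * frac_int (1 - a) u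
        = (\<integral>\<^sup>+v. ennreal ((t - u) powr (b - 1)) *
            (ennreal ((u - v) powr (1 - a - 1) * f v) * indicator {..<u} v) \<partial>lborel)"
        unfolding frac_int_def by (rule nn_integral_cmult [symmetric]) measurable
      also have "\<dots> = (\<integral>\<^sup>+v. H u v \<partial>lborel)"
        using True by (intro nn_integral_cong) (simp add: H_def indicator_def f_nonneg ennreal_mult mult.assoc)
      finally show ?thesis using True by simp
    next
      case False
      then show ?thesis by (simp add: H_def)
    qed
    show "AE u in lborel. ennreal ((t - u) powr (b - 1)) * indicator {..<t} u * ennreal (u * f u)
        = ennreal (a / Gamma (1 - a)) * (\<integral>\<^sup>+v. H u v \<partial>lborel)"
      using stable_density_equation
    proof eventually_elim
      case (elim u)
      show ?case unfolding elim inner[symmetric] by (simp only: mult_ac)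
    qed
  qed
  also have "\<dots> = ennreal (a / Gamma (1 - a)) * (\<integral>\<^sup>+v. (\<integral>\<^sup>+u. H u v \<partial>lborel) \<partial>lborel)"
    using lborel_pair.Fubini'[of H] by (subst nn_integral_cmult) auto
  also have "(\<integral>\<^sup>+v. (\<integral>\<^sup>+u. H u v \<partial>lborel) \<partial>lborel) = ennreal (Beta b (1 - a)) * frac_int (b + (1 - a)) t"
    unfolding frac_int_def
  proof (subst nn_integral_cmult [symmetric])
    show "(\<integral>\<^sup>+v. (\<integral>\<^sup>+u. H u v \<partial>lborel) \<partial>lborel) = (\<integral>\<^sup>+v. ennreal (Beta b (1 - a)) *
        (ennreal ((t - v) powr (b + (1 - a) - 1) * f v) * indicator {..<t} v) \<partial>lborel)"
    proof (rule nn_integral_cong)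
      fix v :: real
      have "(\<integral>\<^sup>+u. H u v \<partial>lborel) = ennreal (f v) *
         (\<integral>\<^sup>+u. ennreal ((t - u) powr (b - 1) * (u - v) powr ((1 - a) - 1)) * indicator {v<..<t} u \<partial>lborel)"
        by (subst nn_integral_cmult [symmetric])
           (auto intro!: nn_integral_cong simp: H_def f_nonneg ennreal_mult'' mult_ac)
      also have "\<dots> = ennreal (Beta b (1 - a)) *
          (ennreal ((t - v) powr (b + (1 - a) - 1) * f v) * indicator {..<t} v)"
      proof (cases "v < t")
        case True
        have pa: "0 < 1 - a" using a by simp
        show ?thesis
          unfolding nn_integral_Beta_real[OF assms pa True] using True
          by (simp add: ennreal_mult'' f_nonneg mult_ac)
      qed simp
      finally show "(\<integral>\<^sup>+u. H u v \<partial>lborel) = ennreal (Beta b (1 - a)) *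
          (ennreal ((t - v) powr (b + (1 - a) - 1) * f v) * indicator {..<t} v)" .
    qed
  qed simp
  also have "ennreal (a / Gamma (1 - a)) * (ennreal (Beta b (1 - a)) * frac_int (b + (1 - a)) t)
      = ennreal (a * Gamma b / Gamma (b + (1 - a))) * frac_int (b + (1 - a)) t"
  proof -
    have "Gamma (1 - a) > 0" and G: "Gamma b > 0" "Gamma (b + (1 - a)) > 0"
      using a assms by (auto intro!: Gamma_real_pos)
    then have "Gamma (1 - a) \<noteq> 0" by linarith
    then show ?thesis
      using a G by (simp add: Beta_def mult.assoc[symmetric] flip: ennreal_mult)
  qed
  finally show ?thesis .
qed

text \<open>Induction on \<open>k\<close>: the base case is the equation for \<open>f\<close>, and
  the Gamma factors of \<open>frac_int_step\<close> telescope. Only the base case has an exceptional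
  null set, so one null set serves all \<open>k\<close>.\<close>

lemma frac_int_iterate:
  "AE t in lborel. \<forall>k\<ge>1. ennreal (a ^ k / Gamma (real k * (1 - a))) * frac_int (real k * (1 - a)) t
      \<le> ennreal (t ^ k * f t)"
  using stable_density_equation
proof eventually_elim
  case (elim t)
  show ?case
  proof (cases "t \<le> 0")
    case True
    then show ?thesis by (auto simp: frac_int_nonpos)
  next
    case False
    show ?thesis
    proof (intro allI impI)
      fix k :: nat assume "1 \<le> k"
      then show "ennreal (a ^ k / Gamma (real k * (1 - a))) * frac_int (real k * (1 - a)) t
        \<le> ennreal (t ^ k * f t)"
      proof (induction k rule: dec_induct)
        case base
        then show ?case using elim by simp
      next
        case (step k)
        define b where "b = real k * (1 - a)"
        have b: "0 < b" using step a by (simp add: b_def)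
        have b': "real (Suc k) * (1 - a) = b + (1 - a)" by (simp add: b_def algebra_simps)
        have G: "0 < Gamma b" "0 < Gamma (b + (1 - a))" using b a by (auto intro!: Gamma_real_pos)
        have "ennreal (a ^ Suc k / Gamma (b + (1 - a))) * frac_int (b + (1 - a)) t
          = ennreal (a ^ k / Gamma b) * (ennreal (a * Gamma b / Gamma (b + (1 - a))) * frac_int (b + (1 - a)) t)"
        proof -
          have "a ^ Suc k / Gamma (b + (1 - a)) = a ^ k / Gamma b * (a * Gamma b / Gamma (b + (1 - a)))"
            using G by simp
          then have "ennreal (a ^ Suc k / Gamma (b + (1 - a)))
              = ennreal (a ^ k / Gamma b) * ennreal (a * Gamma b / Gamma (b + (1 - a)))"
            using G a by (simp only: ennreal_mult less_imp_le zero_le_power divide_nonneg_nonneg mult_nonneg_nonneg)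
          then show ?thesis by (simp only: mult.assoc)
        qed
        also have "\<dots> \<le> ennreal (a ^ k / Gamma b) * (ennreal t * frac_int b t)"
          by (intro mult_left_mono frac_int_step b) simp
        also have "\<dots> = ennreal t * (ennreal (a ^ k / Gamma b) * frac_int b t)"
          by (simp add: mult_ac)
        also have "\<dots> \<le> ennreal t * ennreal (t ^ k * f t)"
          using step.IH by (intro mult_left_mono) (auto simp: b_def)
        also have "\<dots> = ennreal (t ^ Suc k * f t)"
          using False f_nonneg by (simp add: mult.assoc flip: ennreal_mult)
        finally show ?case unfolding b' .
      qed
    qed
  qed
qed

section \<open>Exponential bounds for fractional integrals and for the density\<close>

lemma frac_int_le:
  assumes "0 \<le> m" "0 < t"
  shows "frac_int (m + 1) t \<le> ennreal (t powr m * exp (- ((m / t) powr a)))"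
proof -
  have "frac_int (m + 1) t \<le> (\<integral>\<^sup>+u. ennreal (t powr m) * ennreal (exp (- ((m / t) * u)) * f u) \<partial>lborel)"
    unfolding frac_int_def
  proof (rule nn_integral_mono)
    fix u
    show "ennreal ((t - u) powr (m + 1 - 1) * f u) * indicator {..<t} u
        \<le> ennreal (t powr m) * ennreal (exp (- ((m / t) * u)) * f u)"
    proof (cases "0 < u \<and> u < t")
      case True
      have "t * (1 - u / t) = t - u" using assms by (simp add: field_simps)
      then have "(t - u) powr m = (t * (1 - u / t)) powr m" by simp
      also have "\<dots> = t powr m * (1 - u / t) powr m"
        using assms True by (subst powr_mult) auto
      also have "(1 - u / t) powr m \<le> exp (- (u / t)) powr m"
        using exp_ge_add_one_self[of "- (u / t)"] assms True by (intro powr_mono2) auto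
      also have "exp (- (u / t)) powr m = exp (- ((m / t) * u))"
        by (simp add: exp_powr_real mult.commute)
      finally have "(t - u) powr m \<le> t powr m * exp (- ((m / t) * u))" by (simp add: mult_left_mono)
      from mult_right_mono[OF this f_nonneg[of u]] show ?thesis
        using True by (simp add: f_nonneg mult.assoc flip: ennreal_mult)
    next
      case False
      then show ?thesis by (auto simp: indicator_def f_supp)
    qed
  qed
  also have "\<dots> = ennreal (t powr m) * ennreal (exp (- ((m / t) powr a)))"
    using assms laplace[of "m / t"] by (subst nn_integral_cmult) auto
  finally show ?thesis by (simp flip: ennreal_mult)
qed

lemma frac_int_one: "frac_int 1 t = (\<integral>\<^sup>+u. ennreal (f u) * indicator {..<t} u \<partial>lborel)"
  unfolding frac_int_def by (intro nn_integral_cong) (auto simp: indicator_def)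

text \<open>On \<open>0 < u < t\<close> the kernel \<open>(t - u) powr (- a)\<close> of the integral
  equation is at least \<open>t powr (- a)\<close>. Lower bounds for the distribution function thus
  become lower bounds for \<open>f\<close>.\<close>

lemma density_ge:
  "AE t in lborel. 0 < t \<longrightarrow> ennreal (a / Gamma (1 - a) * t powr (- a)) * frac_int 1 t \<le> ennreal (t * f t)"
  using stable_density_equation
proof eventually_elim
  case (elim t)
  show ?case
  proof
    assume t: "0 < t"
    have "ennreal (t powr (- a)) * frac_int 1 t
        = (\<integral>\<^sup>+u. ennreal (t powr (- a)) * (ennreal (f u) * indicator {..<t} u) \<partial>lborel)"
      unfolding frac_int_one by (subst nn_integral_cmult) auto
    also have "\<dots> \<le> frac_int (1 - a) t"
      unfolding frac_int_def
    proof (rule nn_integral_mono)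
      fix u
      show "ennreal (t powr (- a)) * (ennreal (f u) * indicator {..<t} u)
          \<le> ennreal ((t - u) powr (1 - a - 1) * f u) * indicator {..<t} u"
      proof (cases "0 < u \<and> u < t")
        case True
        then have "t powr (- a) \<le> (t - u) powr (- a)" using a by (intro powr_mono2') auto
        from mult_right_mono[OF this f_nonneg[of u]] show ?thesis
          using True by (simp add: ennreal_leI f_nonneg flip: ennreal_mult)
      next
        case False
        then show ?thesis by (auto simp: indicator_def f_supp)
      qed
    qed
    finally have "ennreal (a / Gamma (1 - a)) * (ennreal (t powr (- a)) * frac_int 1 t)
        \<le> ennreal (a / Gamma (1 - a)) * frac_int (1 - a) t"
      by (rule mult_left_mono) simp
    then show "ennreal (a / Gamma (1 - a) * t powr (- a)) * frac_int 1 t \<le> ennreal (t * f t)"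
      using a unfolding elim by (simp add: ennreal_mult mult.assoc Gamma_real_pos less_imp_le del: times_divide_eq_left)
  qed
qed

text \<open>In the Laplace integral the mass beyond \<open>t\<close> contributes at most
  \<open>exp (- (l * t))\<close>, which by the assumption on \<open>l\<close> is at most half of the
  total; the other half must come from below \<open>t\<close>.\<close>

lemma distribution_ge:
  assumes "0 < l" "l powr a + ln 2 \<le> l * t"
  shows "ennreal (exp (- (l powr a)) / 2) \<le> frac_int 1 t"
proof -
  have "ennreal (exp (- (l powr a))) = (\<integral>\<^sup>+u. ennreal (exp (- (l * u)) * f u) \<partial>lborel)"
    using assms by (simp add: laplace)
  also have "\<dots> \<le> (\<integral>\<^sup>+u. ennreal (f u) * indicator {..<t} u + ennreal (exp (- (l * t))) * ennreal (f u) \<partial>lborel)"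
  proof (rule nn_integral_mono)
    fix u
    show "ennreal (exp (- (l * u)) * f u)
        \<le> ennreal (f u) * indicator {..<t} u + ennreal (exp (- (l * t))) * ennreal (f u)"
    proof (cases "u < t")
      case True
      have "exp (- (l * u)) * f u \<le> f u"
        using assms f_nonneg[of u] f_supp[of u] by (cases "u \<le> 0") (auto intro!: mult_left_le_one_le)
      then show ?thesis using True by (simp add: ennreal_leI add_increasing2)
    next
      case False
      then have "exp (- (l * u)) * f u \<le> exp (- (l * t)) * f u"
        using assms f_nonneg[of u] by (intro mult_right_mono) auto
      then show ?thesis using False by (simp add: ennreal_leI f_nonneg flip: ennreal_mult)
    qed
  qed
  also have "\<dots> = frac_int 1 t + ennreal (exp (- (l * t)))"
    unfolding frac_int_one by (simp add: nn_integral_add nn_integral_cmult total_mass)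
  also have "exp (- (l * t)) \<le> exp (- (l powr a)) / 2"
  proof -
    have "exp (- (l * t)) \<le> exp (- (l powr a + ln 2))" using assms by simp
    also have "\<dots> = exp (- (l powr a)) / 2" by (simp add: exp_diff exp_minus exp_add field_simps)
    finally show ?thesis .
  qed
  then have "frac_int 1 t + ennreal (exp (- (l * t))) \<le> frac_int 1 t + ennreal (exp (- (l powr a)) / 2)"
    by (intro add_left_mono ennreal_leI)
  finally have "ennreal (exp (- (l powr a)) / 2) + ennreal (exp (- (l powr a)) / 2)
      \<le> ennreal (exp (- (l powr a)) / 2) + frac_int 1 t"
    by (simp add: add.commute flip: ennreal_plus)
  then show ?thesis by (subst (asm) ennreal_add_left_cancel_le) auto
qed

text \<open>Chernoff bound: \<open>1 \<le> exp (l * (t - u))\<close> for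
  \<open>u < t\<close>.\<close>

lemma distribution_le:
  assumes "0 \<le> l"
  shows "frac_int 1 t \<le> ennreal (exp (l * t - l powr a))"
proof -
  have "frac_int 1 t \<le> (\<integral>\<^sup>+u. ennreal (exp (l * t)) * ennreal (exp (- (l * u)) * f u) \<partial>lborel)"
    unfolding frac_int_one
  proof (rule nn_integral_mono)
    fix u
    show "ennreal (f u) * indicator {..<t} u \<le> ennreal (exp (l * t)) * ennreal (exp (- (l * u)) * f u)"
    proof (cases "u < t")
      case True
      have "1 \<le> exp (l * t) * exp (- (l * u))"
        using True assms by (simp add: mult_left_mono flip: exp_add)
      from mult_right_mono[OF this f_nonneg[of u]] show ?thesis
        using True by (simp add: ennreal_leI f_nonneg mult.assoc flip: ennreal_mult)
    qed simp
  qed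
  also have "\<dots> = ennreal (exp (l * t)) * ennreal (exp (- (l powr a)))"
    using assms by (subst nn_integral_cmult) (auto simp: laplace)
  also have "\<dots> = ennreal (exp (l * t - l powr a))"
    by (simp add: exp_diff exp_minus field_simps flip: ennreal_mult)
  finally show ?thesis .
qed

text \<open>The range is cut at \<open>u = \<theta> * t\<close>. On the right part \<open>N\<close>
  powers of \<open>t - u\<close> are bounded by \<open>(1 - \<theta>) * t\<close>; on the left part
  all powers are bounded by those of \<open>t\<close>, the exponent being nonnegative because
  \<open>1 \<le> N + b\<close>.\<close>

lemma frac_int_split:
  assumes "0 < t" "0 < \<theta>" "\<theta> < 1" "0 \<le> N" "1 \<le> N + b"
  shows "frac_int (N + b) t \<le> ennreal (((1 - \<theta>) * t) powr N) * frac_int b t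
      + ennreal (t powr (N + b - 1)) * frac_int 1 (\<theta> * t)"
proof -
  have "frac_int (N + b) t \<le> (\<integral>\<^sup>+u. ennreal (((1 - \<theta>) * t) powr N) *
        (ennreal ((t - u) powr (b - 1) * f u) * indicator {..<t} u)
      + ennreal (t powr (N + b - 1)) * (ennreal (f u) * indicator {..<\<theta> * t} u) \<partial>lborel)"
    unfolding frac_int_def
  proof (rule nn_integral_mono)
    fix u
    show "ennreal ((t - u) powr (N + b - 1) * f u) * indicator {..<t} u
       \<le> ennreal (((1 - \<theta>) * t) powr N) * (ennreal ((t - u) powr (b - 1) * f u) * indicator {..<t} u)
      + ennreal (t powr (N + b - 1)) * (ennreal (f u) * indicator {..<\<theta> * t} u)"
    proof (cases "0 < u \<and> u < t")
      case True
      show ?thesis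
      proof (cases "u < \<theta> * t")
        case u: True
        have "(t - u) powr (N + b - 1) \<le> t powr (N + b - 1)"
          using True assms by (intro powr_mono2) auto
        from mult_right_mono[OF this f_nonneg[of u]] show ?thesis
          using True u by (simp add: ennreal_leI f_nonneg add_increasing flip: ennreal_mult)
      next
        case u: False
        have "(t - u) powr (N + b - 1) = (t - u) powr N * (t - u) powr (b - 1)"
          by (simp add: powr_add[symmetric] algebra_simps)
        also have "\<dots> \<le> ((1 - \<theta>) * t) powr N * (t - u) powr (b - 1)"
          using True u assms by (intro mult_right_mono powr_mono2) (auto simp: algebra_simps)
        finally have "(t - u) powr (N + b - 1) \<le> ((1 - \<theta>) * t) powr N * (t - u) powr (b - 1)" .
        from mult_right_mono[OF this f_nonneg[of u]] show ?thesis
          using True u by (simp add: ennreal_leI f_nonneg mult.assoc flip: ennreal_mult)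
      qed
    qed (auto simp: f_supp indicator_def)
  qed
  also have "\<dots> = ennreal (((1 - \<theta>) * t) powr N) * frac_int b t
      + ennreal (t powr (N + b - 1)) * frac_int 1 (\<theta> * t)"
    unfolding frac_int_one unfolding frac_int_def by (simp add: nn_integral_add nn_integral_cmult)
  finally show ?thesis .
qed

text \<open>With \<open>n = b + a * c\<close>, write \<open>Gamma n * t powr (- n)\<close> as the
  integral of \<open>x powr (n - 1) * exp (- (t * x))\<close> and exchange the integrations: the
  Laplace transform of \<open>frac_int b\<close> appears, and the remaining
  \<open>x\<close>-integral is a Gamma integral in \<open>x powr a\<close>. It provides the total
  mass of the mixing kernel.\<close>

lemma nn_integral_frac_int:
  assumes "0 < b" "0 < c"
  shows "(\<integral>\<^sup>+t. ennreal (t powr (- (b + a * c))) * frac_int b t \<partial>lborel)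
      = ennreal (Gamma b * Gamma c / (a * Gamma (b + a * c)))"
proof -
  define n where "n = b + a * c"
  have n: "0 < n" using assms a by (simp add: n_def add_pos_pos)
  define H where "H t x = ennreal (x powr (n - 1) * exp (- (t * x))) * indicator {0<..} x * frac_int b t"
    for t x :: real
  have H_meas [measurable]: "case_prod H \<in> borel_measurable (lborel \<Otimes>\<^sub>M lborel)"
    unfolding H_def by measurable
  have G: "0 < Gamma n" "0 < Gamma b" "0 < Gamma c"
    using n assms by (auto intro!: Gamma_real_pos)
  have "ennreal (Gamma n) * (\<integral>\<^sup>+t. ennreal (t powr (- n)) * frac_int b t \<partial>lborel)
      = (\<integral>\<^sup>+t. ennreal (Gamma n * t powr (- n)) * frac_int b t \<partial>lborel)"
    using G by (subst nn_integral_cmult [symmetric]) (auto intro!: nn_integral_cong simp: ennreal_mult mult.assoc)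
  also have "\<dots> = (\<integral>\<^sup>+t. (\<integral>\<^sup>+x. H t x \<partial>lborel) \<partial>lborel)"
  proof (rule nn_integral_cong)
    fix t :: real
    show "ennreal (Gamma n * t powr (- n)) * frac_int b t = (\<integral>\<^sup>+x. H t x \<partial>lborel)"
      unfolding H_def using n
      by (subst nn_integral_multc, simp, cases "0 < t") (simp_all add: nn_integral_Gamma_real frac_int_nonpos)
  qed
  also have "\<dots> = (\<integral>\<^sup>+x. (\<integral>\<^sup>+t. H t x \<partial>lborel) \<partial>lborel)"
    using lborel_pair.Fubini'[of H] by simp
  also have "\<dots> = (\<integral>\<^sup>+x. ennreal (Gamma b) * (ennreal (x powr (a * c - 1) * exp (- (x powr a))) * indicator {0<..} x) \<partial>lborel)"
  proof (rule nn_integral_cong)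
    fix x :: real
    have "(\<integral>\<^sup>+t. H t x \<partial>lborel) = ennreal (x powr (n - 1)) * indicator {0<..} x *
       (\<integral>\<^sup>+t. ennreal (exp (- (x * t))) * frac_int b t \<partial>lborel)"
      unfolding H_def by (subst nn_integral_cmult [symmetric])
        (auto intro!: nn_integral_cong simp: ennreal_mult mult_ac)
    also have "\<dots> = ennreal (Gamma b) * (ennreal (x powr (a * c - 1) * exp (- (x powr a))) * indicator {0<..} x)"
    proof (cases "0 < x")
      case True
      have "x powr (n - 1) * x powr (- b) = x powr (a * c - 1)"
        by (simp add: n_def algebra_simps flip: powr_add)
      then have "x powr (n - 1) * (Gamma b * x powr (- b) * exp (- (x powr a)))
          = Gamma b * (x powr (a * c - 1) * exp (- (x powr a)))"
        by (simp add: mult_ac)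
      then show ?thesis using True assms G by (simp add: laplace_frac_int flip: ennreal_mult)
    qed simp
    finally show "(\<integral>\<^sup>+t. H t x \<partial>lborel) = ennreal (Gamma b) *
        (ennreal (x powr (a * c - 1) * exp (- (x powr a))) * indicator {0<..} x)" .
  qed
  also have "\<dots> = ennreal (Gamma b) * ennreal (Gamma c / a)"
    using a assms by (subst nn_integral_cmult) (auto simp: nn_integral_powr_exp_powr)
  finally have "ennreal (1 / Gamma n) * (ennreal (Gamma n) * (\<integral>\<^sup>+t. ennreal (t powr (- n)) * frac_int b t \<partial>lborel))
      = ennreal (1 / Gamma n) * (ennreal (Gamma b) * ennreal (Gamma c / a))"
    by simp
  then show ?thesis
    using G a unfolding n_def[symmetric]
    by (simp add: mult.assoc[symmetric] flip: ennreal_mult)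
qed

end

section \<open>Estimates of the normalising constants\<close>

text \<open>The three-slope inequality of the convex function \<open>ln Gamma\<close>, with
  denominators cleared.\<close>

lemma ln_Gamma_slope_le:
  assumes "0 < x" "0 < y" "(0::real) < z" "x < y" "y < z"
  shows "(z - y) * (ln (Gamma y) - ln (Gamma x)) \<le> (y - x) * (ln (Gamma z) - ln (Gamma y))"
proof -
  define u where "u = (y - x) / (z - x)"
  have u: "0 \<le> u" "u \<le> 1" using assms by (auto simp: u_def)
  have y: "(1 - u) *\<^sub>R x + u *\<^sub>R z = y"
  proof -
    have "u * (z - x) = y - x" using assms by (simp add: u_def)
    then show ?thesis by (simp add: algebra_simps)
  qed
  have "ln (Gamma y) \<le> (1 - u) * ln (Gamma x) + u * ln (Gamma z)"
    using convex_onD[OF log_convex_Gamma_real u, of x z] assms unfolding y by simp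
  then have "(z - x) * ln (Gamma y) \<le> (z - x) * ((1 - u) * ln (Gamma x) + u * ln (Gamma z))"
    using assms by (intro mult_left_mono) auto
  also have "\<dots> = (z - y) * ln (Gamma x) + (y - x) * ln (Gamma z)"
  proof -
    have "(z - x) * u = y - x" "(z - x) * (1 - u) = z - y"
      using assms by (auto simp: u_def field_simps)
    then show ?thesis by (simp add: distrib_left mult.assoc[symmetric])
  qed
  finally show ?thesis by (simp add: algebra_simps)
qed

text \<open>By convexity the slope of \<open>ln Gamma\<close> between \<open>x\<close> and
  \<open>y\<close> is at most its slope between \<open>y\<close> and \<open>y + 1\<close>, which is
  \<open>ln y\<close> by the functional equation.\<close>

lemma Gamma_ratio_le:
  assumes "0 < x" "x \<le> (y::real)"
  shows "Gamma y / Gamma x \<le> y powr (y - x)"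
proof (cases "x = y")
  case True
  then show ?thesis using assms by simp
next
  case False
  have G: "0 < Gamma x" "0 < Gamma y" using assms by (auto intro!: Gamma_real_pos)
  have "ln (Gamma (y + 1)) = ln y + ln (Gamma y)"
  proof -
    have "y \<notin> \<int>\<^sub>\<le>\<^sub>0" using assms by (auto elim!: nonpos_Ints_cases)
    moreover have "Gamma y \<noteq> 0" using G by linarith
    ultimately show ?thesis using assms by (simp add: Gamma_plus1 ln_mult)
  qed
  then have "ln (Gamma y) - ln (Gamma x) \<le> (y - x) * ln y"
    using ln_Gamma_slope_le[of x y "y + 1"] assms False by simp
  then have "ln (Gamma y / Gamma x) \<le> ln (y powr (y - x))"
    using assms G less_imp_neq[OF G(1)] less_imp_neq[OF G(2)] by (simp add: ln_div ln_powr)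
  then show ?thesis using assms G by (subst (asm) ln_le_cancel_iff) auto
qed

text \<open>A single term of the exponential series. For \<open>x = k\<close> it serves as a
  Stirling bound, \<open>k ^ k / fact k \<le> exp k\<close>.\<close>

lemma power_div_fact_le_exp:
  assumes "0 \<le> (x::real)"
  shows "x ^ k / fact k \<le> exp x"
proof -
  have "(\<Sum>n\<in>{k}. x ^ n /\<^sub>R fact n) \<le> (\<Sum>n. x ^ n /\<^sub>R fact n)"
    using assms summable_exp_generic[of x] by (intro sum_le_suminf) auto
  then show ?thesis by (simp add: exp_def field_simps)
qed

text \<open>\<open>1 + ln y - y\<close> has its strict maximum 0 at \<open>y = 1\<close>; away from
  1 the gap is large enough to lower the coefficient of \<open>y\<close> to some
  \<open>\<theta> < 1\<close> and still keep a uniform \<open>\<kappa>\<close>.\<close>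

lemma ln_minus_linear_off_one:
  assumes "0 < y1" "y1 < 1" "1 < (y2::real)"
  obtains \<theta> \<kappa> :: real where "0 < \<theta>" "\<theta> < 1" "0 < \<kappa>"
    "\<And>y. 0 < y \<Longrightarrow> y \<le> y1 \<or> y2 \<le> y \<Longrightarrow> 1 + ln y - \<theta> * y \<le> - \<kappa>"
proof -
  have lt: "(1 + ln y) / y < 1" if "0 < y" "y \<noteq> 1" for y :: real
    using ln_eq_minus_one[of y] ln_le_minus_one[of y] that by (auto simp: pos_divide_less_eq less_le)
  \<comment> \<open>A \<open>\<theta>\<close> above the first two numbers makes the expression
    negative at \<open>y1\<close> and \<open>y2\<close>; above the third, it exceeds the slope of
    \<open>ln\<close> at \<open>y2\<close>, so the expression decreases from there on.\<close>
  define M where "M = Max {(1 + ln y1) / y1, (1 + ln y2) / y2, 1 / y2}"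
  have M: "M < 1" "(1 + ln y1) / y1 \<le> M" "(1 + ln y2) / y2 \<le> M" "1 / y2 \<le> M"
    using assms lt[of y1] lt[of y2] by (auto simp: M_def)
  define \<theta> where "\<theta> = (1 + M) / 2"
  have "0 < 1 / y2" using assms by simp
  then have "0 < M" using M(4) by (rule less_le_trans)
  with M have \<theta>: "0 < \<theta>" "\<theta> < 1" "M < \<theta>" by (auto simp: \<theta>_def)
  define \<kappa> where "\<kappa> = min (\<theta> * y1 - (1 + ln y1)) (\<theta> * y2 - (1 + ln y2))"
  have "(1 + ln y1) / y1 < \<theta>" "(1 + ln y2) / y2 < \<theta>" "1 / y2 < \<theta>" using M \<theta> by linarith+
  then have \<kappa>: "0 < \<kappa>" using assms by (auto simp: \<kappa>_def field_simps)
  \<comment> \<open>Comparison with the tangents at \<open>y1\<close> and \<open>y2\<close> reduces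
    all admissible \<open>y\<close> to these two points.\<close>
  have tangent: "ln y \<le> ln c + (y - c) / c" if "0 < y" "0 < c" for y c :: real
    using ln_le_minus_one[of "y / c"] that by (simp add: ln_div diff_divide_distrib)
  have "1 + ln y - \<theta> * y \<le> - \<kappa>" if y: "0 < y" "y \<le> y1 \<or> y2 \<le> y" for y
    using y(2)
  proof
    assume "y \<le> y1"
    have "1 \<le> 1 / y1" using assms by simp
    then have "(y - y1) * (1 / y1 - \<theta>) \<le> 0"
      using \<open>y \<le> y1\<close> \<theta> by (intro mult_nonpos_nonneg) linarith+
    then have "(y - y1) / y1 \<le> \<theta> * (y - y1)" by (simp add: algebra_simps)
    then have "1 + ln y - \<theta> * y \<le> 1 + ln y1 - \<theta> * y1"
      using tangent[of y y1] y assms by (simp add: algebra_simps)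
    also have "\<dots> \<le> - \<kappa>" by (simp add: \<kappa>_def)
    finally show ?thesis .
  next
    assume "y2 \<le> y"
    then have "(y - y2) * (1 / y2 - \<theta>) \<le> 0"
      using \<open>1 / y2 < \<theta>\<close> by (intro mult_nonneg_nonpos) linarith+
    then have "(y - y2) / y2 \<le> \<theta> * (y - y2)" by (simp add: algebra_simps)
    then have "1 + ln y - \<theta> * y \<le> 1 + ln y2 - \<theta> * y2"
      using tangent[of y y2] y assms by (simp add: algebra_simps)
    also have "\<dots> \<le> - \<kappa>" by (simp add: \<kappa>_def)
    finally show ?thesis .
  qed
  with \<theta> \<kappa> show ?thesis using that by blast
qed

text \<open>The quotient of the factor \<open>a ^ k / Gamma (n - k * a)\<close> in the weight by the
  claimed asymptotics \<open>a ^ (k - 1) * Gamma k / Gamma n\<close>.\<close>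

definition kingman_const :: "real \<Rightarrow> nat \<Rightarrow> nat \<Rightarrow> real" where
  "kingman_const a n k = a * Gamma (real n) / (Gamma (real k) * Gamma (real n - real k * a))"

lemma kingman_const_pos:
  assumes "0 < a" "a < 1" "1 \<le> k" "k \<le> n"
  shows "real k * a < real n" "0 < kingman_const a n k"
proof -
  have "real k * a < real k * 1" using assms by (intro mult_strict_left_mono) auto
  moreover have "real k \<le> real n" using assms by simp
  ultimately show kn: "real k * a < real n" by linarith
  show "0 < kingman_const a n k"
    using assms kn by (auto simp: kingman_const_def intro!: mult_pos_pos divide_pos_pos Gamma_real_pos)
qed

lemma kingman_const_le:
  assumes "0 < a" "a < 1" "1 \<le> k" "k \<le> n"
  shows "kingman_const a n k \<le> a * real n powr (real k * a) / Gamma (real k)"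
proof -
  have "Gamma (real n) / Gamma (real n - real k * a) \<le> real n powr (real k * a)"
    using Gamma_ratio_le[of "real n - real k * a" "real n"] kingman_const_pos[OF assms] assms by simp
  moreover have "kingman_const a n k = a / Gamma (real k) * (Gamma (real n) / Gamma (real n - real k * a))"
    by (simp add: kingman_const_def)
  moreover have "0 \<le> a / Gamma (real k)" using assms by (auto intro!: divide_nonneg_pos Gamma_real_pos)
  ultimately show ?thesis
    using mult_left_mono by fastforce
qed

text \<open>With \<open>X = (n / t) powr a = k * y\<close> the constant and the powers of
  \<open>t\<close> combine to \<open>X ^ k / Gamma k\<close>, of size \<open>exp k * y ^ k\<close>
  up to a factor \<open>k\<close>, while the exponential is at most
  \<open>exp (- (\<theta> * X))\<close>. The product is governed by
  \<open>exp (k * (1 + ln y - \<theta> * y))\<close>.\<close>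

lemma bulk_estimate:
  assumes a: "0 < a" "a < 1" and k: "1 \<le> k" "k \<le> n" and t: "0 < t"
    and y: "y = real n powr a / (real k * t powr a)"
    and m: "0 \<le> m" "\<theta> \<le> (1 - \<eta> powr a) * (m / real n) powr a" and \<eta>: "0 \<le> \<eta>" and \<theta>: "0 \<le> \<theta>"
    and \<kappa>: "1 + ln y - \<theta> * y \<le> - \<kappa>"
  shows "kingman_const a n k * t powr (- ((real k - 1) * a)) * exp (- ((m / t) powr a - (\<eta> * m / t) powr a))
      \<le> a * exp 1 * real n powr a * exp (- ((real k - 1) * \<kappa>))"
proof -
  define X where "X = (real n / t) powr a"
  have n: "0 < real n" using k by simp
  have X: "0 < X" using n t by (simp add: X_def)
  have Xky: "X = real k * y" using n t k by (simp add: X_def y powr_divide)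
  have y0: "0 < y" using n t k by (simp add: y)
  have Xk: "X ^ k = real n powr (real k * a) * t powr (- (real k * a))"
    using n t by (simp add: X_def powr_divide powr_minus_divide powr_power mult.commute power_divide)
  have mt: "(m / t) powr a - (\<eta> * m / t) powr a = (1 - \<eta> powr a) * (m / t) powr a"
    using m \<eta> t by (simp add: powr_mult powr_divide left_diff_distrib diff_divide_distrib)
  have "(m / t) powr a = (m / real n) powr a * X"
    using m n t by (simp add: X_def powr_divide)
  then have "\<theta> * X \<le> (m / t) powr a - (\<eta> * m / t) powr a"
    using mult_right_mono[OF m(2) less_imp_le[OF X]] unfolding mt by (simp add: mult.assoc)
  then have 1: "exp (- ((m / t) powr a - (\<eta> * m / t) powr a)) \<le> exp (- (\<theta> * X))" by simp
  have G: "0 < Gamma (real k)" using k by (auto intro!: Gamma_real_pos)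
  have tk: "t powr (- ((real k - 1) * a)) = t powr a * t powr (- (real k * a))"
    by (simp add: algebra_simps flip: powr_add)
  have "kingman_const a n k * t powr (- ((real k - 1) * a))
      \<le> a * real n powr (real k * a) / Gamma (real k) * t powr (- ((real k - 1) * a))"
    by (intro mult_right_mono kingman_const_le a k) simp
  also have "\<dots> = a * t powr a * (X ^ k / Gamma (real k))"
    by (simp add: Xk tk)
  also have "X ^ k / Gamma (real k) \<le> real k * (exp (real k) * y ^ k)"
  proof -
    have "Gamma (real k) = fact (k - 1)" using Gamma_fact[of "k - 1"] k by (simp add: of_nat_diff)
    then have "real k * Gamma (real k) = fact k" using k by (simp add: fact_reduce)
    moreover have "Gamma (real k) \<noteq> 0" using G by simp
    ultimately have "1 / Gamma (real k) = real k / fact k" by (simp add: field_simps)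
    moreover have "X ^ k / Gamma (real k) = X ^ k * (1 / Gamma (real k))" by simp
    ultimately have "X ^ k / Gamma (real k) = X ^ k * (real k / fact k)" by simp
    then have "X ^ k / Gamma (real k) = real k * (real k ^ k / fact k * y ^ k)"
      by (simp add: Xky power_mult_distrib)
    also have "\<dots> \<le> real k * (exp (real k) * y ^ k)"
      using y0 by (intro mult_left_mono mult_right_mono power_div_fact_le_exp) auto
    finally show ?thesis .
  qed
  finally have 2: "kingman_const a n k * t powr (- ((real k - 1) * a))
     \<le> a * t powr a * (real k * (exp (real k) * y ^ k))" using a by (simp add: mult_left_mono)
  have ty: "t powr a * real k = real n powr a / y" using k t n by (simp add: y field_simps)
  have "kingman_const a n k * t powr (- ((real k - 1) * a)) * exp (- ((m / t) powr a - (\<eta> * m / t) powr a))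
     \<le> a * t powr a * (real k * (exp (real k) * y ^ k)) * exp (- (\<theta> * X))"
    by (rule mult_mono[OF 2 1]) (use y0 a in auto)
  also have "\<dots> = a * (t powr a * real k) * (exp (real k) * y ^ k * exp (- (\<theta> * X)))" by simp
  \<comment> \<open>One of the \<open>k\<close> equal factors is kept apart as
    \<open>y * exp (1 - \<theta> * y)\<close>: its \<open>y\<close> cancels against
    \<open>ty\<close>, and the rest is at most \<open>exp 1\<close>. This frees the bound of
    \<open>t\<close>.\<close>
  also have "exp (real k) * y ^ k * exp (- (\<theta> * X)) = y * exp (1 - \<theta> * y) * exp ((real k - 1) * (1 + ln y - \<theta> * y))"
  proof -
    have "y ^ k = y * exp ((real k - 1) * ln y)"
      using y0 k powr_realpow[OF y0, of k] by (simp add: powr_def algebra_simps exp_diff)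
    then have "exp (real k) * y ^ k * exp (- (\<theta> * X)) = y * exp (real k + (real k - 1) * ln y - \<theta> * (real k * y))"
      by (simp add: Xky exp_add exp_diff exp_minus field_simps)
    also have "real k + (real k - 1) * ln y - \<theta> * (real k * y) = (1 - \<theta> * y) + (real k - 1) * (1 + ln y - \<theta> * y)"
      by (simp add: algebra_simps)
    finally show ?thesis by (simp add: exp_add)
  qed
  also have "a * (t powr a * real k) * (y * exp (1 - \<theta> * y) * exp ((real k - 1) * (1 + ln y - \<theta> * y)))
      = a * real n powr a * (exp (1 - \<theta> * y) * exp ((real k - 1) * (1 + ln y - \<theta> * y)))"
    unfolding ty using y0 by simp
  also have "\<dots> \<le> a * real n powr a * (exp 1 * exp (- ((real k - 1) * \<kappa>)))"
  proof -
    have "(real k - 1) * (1 + ln y - \<theta> * y) \<le> (real k - 1) * (- \<kappa>)"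
      using k \<kappa> by (intro mult_left_mono) auto
    then show ?thesis using a y0 \<theta> by (intro mult_left_mono mult_mono) auto
  qed
  finally show ?thesis by (simp add: mult_ac)
qed

section \<open>Limits along block counts of order \<open>n powr a\<close>\<close>

locale block_count_asymptotics =
  fixes a s :: real and k :: "nat \<Rightarrow> nat"
  assumes a: "0 < a" "a < 1" and s: "0 < s"
    and k_range: "1 \<le> n \<Longrightarrow> 1 \<le> k n \<and> k n \<le> n"
    and k_lim: "(\<lambda>n. real (k n) / real n powr a) \<longlonglongrightarrow> s"
begin

lemma k_bounds:
  "\<forall>\<^sub>F n in sequentially. 1 \<le> n \<and> 1 \<le> k n \<and> k n \<le> n \<and>
     s / 2 * real n powr a \<le> real (k n) \<and> real (k n) \<le> 2 * s * real n powr a"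
proof -
  have "\<forall>\<^sub>F n in sequentially. s / 2 < real (k n) / real n powr a"
    "\<forall>\<^sub>F n in sequentially. real (k n) / real n powr a < 2 * s"
    by (rule order_tendstoD[OF k_lim], use s in simp)+
  then show ?thesis using eventually_ge_at_top[of 1]
  proof eventually_elim
    case (elim n)
    then show ?case using k_range[of n] by (auto simp: field_simps)
  qed
qed

text \<open>The exponent of \<open>p\<close> in the inner integral of the weight, that is, the order
  of the fractional integral minus 1.\<close>

definition stick_exponent :: "nat \<Rightarrow> real" where "stick_exponent n = real n - 1 - real (k n) * a"

lemma stick_exponent_lim: "(\<lambda>n. stick_exponent n / real n) \<longlonglongrightarrow> 1"
proof -
  have "(\<lambda>n. real n powr (a - 1)) \<longlonglongrightarrow> 0" "(\<lambda>n. 1 / real n) \<longlonglongrightarrow> 0"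
    using a by real_asymp+
  then have "(\<lambda>n. 1 - 1 / real n - a * (real (k n) / real n powr a * real n powr (a - 1))) \<longlonglongrightarrow> 1 - 0 - a * (s * 0)"
    by (intro tendsto_intros k_lim)
  moreover have "\<forall>\<^sub>F n in sequentially. 1 - 1 / real n - a * (real (k n) / real n powr a * real n powr (a - 1))
      = stick_exponent n / real n"
    using eventually_gt_at_top[of 0]
    by eventually_elim (simp add: stick_exponent_def powr_diff field_simps)
  ultimately show ?thesis by (simp add: tendsto_cong)
qed

lemma stick_exponent_bounds: "\<forall>\<^sub>F n in sequentially. 0 < real n \<and> real n / 2 \<le> stick_exponent n"
  using order_tendstoD(1)[OF stick_exponent_lim, of "1/2", simplified] eventually_gt_at_top[of 0]
  by eventually_elim (auto simp: field_simps)

text \<open>For fixed \<open>t\<close> the variable \<open>y\<close> of \<open>bulk_estimate\<close>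
  tends to \<open>t powr (- a) / s\<close>, which is 1 exactly at \<open>t0\<close>; at distance
  \<open>\<epsilon>\<close> from \<open>t0\<close> it stays off a neighbourhood of 1. The choices
  are made in the order \<open>\<theta>\<close> and \<open>\<kappa>\<close> from
  \<open>\<epsilon>\<close>, then \<open>\<eta>\<close> from \<open>\<theta>\<close>, then
  \<open>n\<close>.\<close>

lemma bulk_eventually:
  assumes "0 < \<epsilon>" "0 < \<delta>"
  obtains \<eta> where "0 < \<eta>" "\<forall>\<^sub>F n in sequentially. \<forall>t>0. \<epsilon> \<le> \<bar>t - s powr (- 1 / a)\<bar> \<longrightarrow>
      kingman_const a n (k n) * t powr (- ((real (k n) - 1) * a)) *
        exp (- ((stick_exponent n / t) powr a - (\<eta> * stick_exponent n / t) powr a)) \<le> \<delta>"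
proof -
  define t0 where "t0 = s powr (- 1 / a)"
  have t0: "0 < t0" "t0 powr (- a) = s" using s a by (simp_all add: t0_def powr_powr)
  \<comment> \<open>The cap \<open>t0 / 2\<close> keeps the lower endpoint \<open>tl\<close>
    positive.\<close>
  define \<epsilon>' where "\<epsilon>' = min \<epsilon> (t0 / 2)"
  define tl where "tl = t0 - \<epsilon>'"
  define tu where "tu = t0 + \<epsilon>'"
  have \<epsilon>': "0 < \<epsilon>'" using assms t0 by (simp add: \<epsilon>'_def)
  have tlu: "0 < tl" "tl < t0" "t0 < tu" using \<epsilon>' t0 by (auto simp: tl_def tu_def \<epsilon>'_def)
  have "t0 powr (- a) < tl powr (- a)" "tu powr (- a) < t0 powr (- a)"
    using tlu t0 a by (auto intro!: powr_less_mono2_neg)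
  then have q: "1 < tl powr (- a) / s" "tu powr (- a) / s < 1" "0 < tu powr (- a) / s"
    using s t0 tlu by auto
  \<comment> \<open>Midpoints between 1 and the limits of \<open>y\<close> at \<open>tu\<close> and
    \<open>tl\<close>: the remaining half of each gap absorbs the error of the convergence.\<close>
  define y1 where "y1 = (1 + tu powr (- a) / s) / 2"
  define y2 where "y2 = (1 + tl powr (- a) / s) / 2"
  have y12: "0 < y1" "y1 < 1" "1 < y2" "tu powr (- a) / s < y1" "y2 < tl powr (- a) / s"
    using q unfolding y1_def y2_def by argo+
  obtain \<theta> \<kappa> :: real where \<theta>: "0 < \<theta>" "\<theta> < 1" "0 < \<kappa>"
    "\<And>y. 0 < y \<Longrightarrow> y \<le> y1 \<or> y2 \<le> y \<Longrightarrow> 1 + ln y - \<theta> * y \<le> - \<kappa>"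
    using ln_minus_linear_off_one[OF y12(1-3)] by blast
  \<comment> \<open>This makes \<open>1 - \<eta> powr a = (1 + \<theta>) / 2\<close>, strictly above
    \<open>\<theta>\<close>, with room for \<open>stick_exponent n / n\<close> being close to 1
    only.\<close>
  define \<eta> where "\<eta> = ((1 - \<theta>) / 2) powr (1 / a)"
  have \<eta>: "0 < \<eta>" "\<eta> powr a = (1 - \<theta>) / 2" using \<theta> a by (simp_all add: \<eta>_def powr_powr)
  have r: "(\<lambda>n. real n powr a / real (k n)) \<longlonglongrightarrow> 1 / s"
    using tendsto_inverse[OF k_lim] s by (simp add: inverse_eq_divide)
  have "(\<lambda>n. real n powr a / real (k n) * tl powr (- a)) \<longlonglongrightarrow> 1 / s * tl powr (- a)"
    "(\<lambda>n. real n powr a / real (k n) * tu powr (- a)) \<longlonglongrightarrow> 1 / s * tu powr (- a)"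
    by (intro tendsto_mult r tendsto_const)+
  then have e1: "\<forall>\<^sub>F n in sequentially. y2 < real n powr a / real (k n) * tl powr (- a)"
    and e2: "\<forall>\<^sub>F n in sequentially. real n powr a / real (k n) * tu powr (- a) < y1"
    using y12 by (auto elim!: order_tendstoD)
  have "(\<lambda>n. (1 - \<eta> powr a) * (stick_exponent n / real n) powr a) \<longlonglongrightarrow> (1 - \<eta> powr a) * 1 powr a"
    by (intro tendsto_intros stick_exponent_lim) auto
  then have e3: "\<forall>\<^sub>F n in sequentially. \<theta> < (1 - \<eta> powr a) * (stick_exponent n / real n) powr a"
    by (rule order_tendstoD) (use \<eta> \<theta> in simp)
  have "(\<lambda>n. a * exp 1 * real n powr a * exp (- ((s / 2 * real n powr a - 1) * \<kappa>))) \<longlonglongrightarrow> 0"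
    using a s \<theta> by real_asymp
  then have e4: "\<forall>\<^sub>F n in sequentially. a * exp 1 * real n powr a * exp (- ((s / 2 * real n powr a - 1) * \<kappa>)) < \<delta>"
    using assms by (auto elim!: order_tendstoD)
  have "\<forall>\<^sub>F n in sequentially. \<forall>t>0. \<epsilon> \<le> \<bar>t - t0\<bar> \<longrightarrow>
      kingman_const a n (k n) * t powr (- ((real (k n) - 1) * a)) *
        exp (- ((stick_exponent n / t) powr a - (\<eta> * stick_exponent n / t) powr a)) \<le> \<delta>"
    using e1 e2 e3 e4 k_bounds stick_exponent_bounds
  proof eventually_elim
    case (elim n)
    show ?case
    proof (intro allI impI)
      fix t :: real assume t: "0 < t" "\<epsilon> \<le> \<bar>t - t0\<bar>"
      define y where "y = real n powr a / (real (k n) * t powr a)"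
      have y: "y = real n powr a / real (k n) * t powr (- a)"
        by (simp add: y_def powr_minus_divide)
      have y0: "0 < y" using elim t by (simp add: y_def)
      have "t \<le> tl \<or> tu \<le> t" using t by (auto simp: tl_def tu_def \<epsilon>'_def)
      then have "y \<le> y1 \<or> y2 \<le> y"
      proof
        assume "t \<le> tl"
        then have "tl powr (- a) \<le> t powr (- a)" using t a by (intro powr_mono2') auto
        then have "real n powr a / real (k n) * tl powr (- a) \<le> y"
          unfolding y by (intro mult_left_mono) auto
        then show ?thesis using elim by linarith
      next
        assume "tu \<le> t"
        then have "t powr (- a) \<le> tu powr (- a)" using t0 tlu a by (intro powr_mono2') auto
        then have "y \<le> real n powr a / real (k n) * tu powr (- a)"
          unfolding y by (intro mult_left_mono) auto
        then show ?thesis using elim by linarith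
      qed
      then have "1 + ln y - \<theta> * y \<le> - \<kappa>" using \<theta>(4) y0 by blast
      then have "kingman_const a n (k n) * t powr (- ((real (k n) - 1) * a)) *
          exp (- ((stick_exponent n / t) powr a - (\<eta> * stick_exponent n / t) powr a))
        \<le> a * exp 1 * real n powr a * exp (- ((real (k n) - 1) * \<kappa>))"
        using elim t \<eta>(1) \<theta> by (intro bulk_estimate[OF a _ _ _ y_def]) auto
      also have "\<dots> \<le> a * exp 1 * real n powr a * exp (- ((s / 2 * real n powr a - 1) * \<kappa>))"
        using elim a \<theta> by (intro mult_left_mono) (auto intro!: mult_right_mono)
      also have "\<dots> \<le> \<delta>" using elim by simp
      finally show "kingman_const a n (k n) * t powr (- ((real (k n) - 1) * a)) *
          exp (- ((stick_exponent n / t) powr a - (\<eta> * stick_exponent n / t) powr a)) \<le> \<delta>" .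
    qed
  qed
  with \<eta> show ?thesis using that unfolding t0_def by blast
qed

text \<open>The power of \<open>1 - \<theta>\<close> decays exponentially in \<open>n\<close>,
  whereas the other factors grow at most like the exponential of a constant times
  \<open>n powr a * ln n\<close>.\<close>

lemma geometric_part_eventually:
  assumes \<theta>: "0 < \<theta>" "\<theta> < 1" and "0 < \<delta>"
  shows "\<forall>\<^sub>F n in sequentially. kingman_const a n (k n) * ((1 - \<theta>) powr (real n - real (k n)) *
      (Gamma (real (k n) * (1 - a)) / a ^ k n)) \<le> \<delta>"
proof -
  define c where "c = - ln (1 - \<theta>)"
  define d where "d = - ln a"
  have cd: "0 < c" "0 < d" using \<theta> a by (simp_all add: c_def d_def)
  have "(\<lambda>n. exp (2 * s * real n powr a * d + 2 * s * real n powr a * a * ln (real n)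
      - (real n - 2 * s * real n powr a) * c)) \<longlonglongrightarrow> 0"
    using a s cd by real_asymp
  then have e1: "\<forall>\<^sub>F n in sequentially. exp (2 * s * real n powr a * d + 2 * s * real n powr a * a * ln (real n)
      - (real n - 2 * s * real n powr a) * c) < \<delta>"
    using assms by (auto elim!: order_tendstoD)
  \<comment> \<open>This puts \<open>K * (1 - a)\<close> at 2 or above, where Gamma is
    increasing.\<close>
  have e2: "\<forall>\<^sub>F n in sequentially. 2 / (1 - a) \<le> s / 2 * real n powr a"
    using a s by real_asymp
  show ?thesis using e1 e2 k_bounds
  proof eventually_elim
    case (elim n)
    define K where "K = real (k n)"
    have K: "1 \<le> K" "K \<le> real n" "K \<le> 2 * s * real n powr a" "2 / (1 - a) \<le> K"
      using elim by (auto simp: K_def)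
    have n: "1 \<le> real n" using K by linarith
    have "2 \<le> K * (1 - a)" using K(4) a by (simp add: pos_divide_le_eq)
    moreover have "K * (1 - a) \<le> K" using K a by simp
    ultimately have "Gamma (K * (1 - a)) \<le> Gamma K"
      using Gamma_real_strict_mono[of "K * (1 - a)" K] a K by (intro less_imp_le) auto
    moreover have G: "0 < Gamma K" "0 < Gamma (K * (1 - a))" using K a by (auto intro!: Gamma_real_pos)
    ultimately have GG: "Gamma (K * (1 - a)) / Gamma K \<le> 1" by simp
    have "kingman_const a n (k n) * ((1 - \<theta>) powr (real n - K) * (Gamma (K * (1 - a)) / a ^ k n))
      \<le> (a * real n powr (K * a) / Gamma K) * ((1 - \<theta>) powr (real n - K) * (Gamma (K * (1 - a)) / a ^ k n))"
      unfolding K_def using elim a G by (intro mult_right_mono kingman_const_le) (auto simp: K_def)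
    also have "\<dots> = real n powr (K * a) * (1 - \<theta>) powr (real n - K) * (a / a ^ k n) * (Gamma (K * (1 - a)) / Gamma K)"
      by (simp add: mult_ac)
    also have "\<dots> \<le> real n powr (K * a) * (1 - \<theta>) powr (real n - K) * (1 / a ^ k n) * 1"
      using a GG G by (intro mult_mono divide_right_mono) auto
    also have "\<dots> = exp (K * d + K * a * ln (real n) - (real n - K) * c)"
      using \<theta> a n by (simp add: c_def d_def K_def powr_def exp_add exp_diff exp_minus ln_realpow field_simps
          flip: powr_realpow)
    also have "\<dots> \<le> exp (2 * s * real n powr a * d + 2 * s * real n powr a * a * ln (real n)
      - (real n - 2 * s * real n powr a) * c)"
    proof -
      have "K * d \<le> 2 * s * real n powr a * d" "K * c \<le> 2 * s * real n powr a * c"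
        "K * (a * ln (real n)) \<le> 2 * s * real n powr a * (a * ln (real n))"
        using K cd a n by (intro mult_right_mono; simp)+
      then show ?thesis by (simp add: algebra_simps)
    qed
    also have "\<dots> \<le> \<delta>" using elim by simp
    finally show ?case by (simp add: K_def)
  qed
qed

text \<open>Let \<open>z = t powr (- (a / (1 - a)))\<close>. Since \<open>n \<le> z / c\<close> and
  \<open>k\<close> is at most a constant times \<open>z powr a\<close>, everything except
  \<open>exp (- z)\<close> is at most the exponential of order \<open>z powr a * ln z\<close>, which
  is negligible against \<open>z\<close>.\<close>

lemma small_time_eventually:
  assumes "0 < c" "0 < C" "0 < \<delta>"
  shows "\<forall>\<^sub>F n in sequentially. \<forall>t>0. c * real n \<le> t powr (- (a / (1 - a))) \<longrightarrow>
    C * kingman_const a n (k n) * t powr (- ((real (k n) - 1) * a)) * exp (- (t powr (- (a / (1 - a))))) \<le> \<delta>"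
proof -
  define C1 where "C1 = 2 * s * c powr (- a)"
  have C1: "0 < C1" using s assms by (simp add: C1_def)
  \<comment> \<open>A bound in \<open>z\<close> alone; its decay gives the estimate uniformly in
    \<open>t\<close>.\<close>
  define B where "B z = C * exp (C1 * a * z powr a * ln (z / c) + C1 * z powr a * ln z - z)" for z
  have "(B \<longlongrightarrow> 0) at_top" unfolding B_def using a assms C1 by real_asymp
  then have "\<forall>\<^sub>F z in at_top. B z < \<delta>" using assms by (auto elim!: order_tendstoD)
  then obtain z0 where z0: "\<And>z. z0 \<le> z \<Longrightarrow> B z < \<delta>" by (auto simp: eventually_at_top_linorder)
  have e1: "\<forall>\<^sub>F n in sequentially. max 1 z0 \<le> c * real n" using assms by real_asymp
  have e2: "\<forall>\<^sub>F n in sequentially. 2 \<le> s / 2 * real n powr a" using a s by real_asymp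
  show ?thesis using e1 e2 k_bounds
  proof eventually_elim
    case (elim n)
    define K where "K = real (k n)"
    have K: "2 \<le> K" "K \<le> 2 * s * real n powr a" using elim by (auto simp: K_def)
    show ?case
    proof (intro allI impI)
      fix t :: real assume t: "0 < t" "c * real n \<le> t powr (- (a / (1 - a)))"
      define z where "z = t powr (- (a / (1 - a)))"
      have z: "1 \<le> z" "z0 \<le> z" "real n \<le> z / c" using t elim assms by (auto simp: z_def field_simps)
      have n: "1 \<le> real n" using elim by simp
      have "real n powr a \<le> (z / c) powr a" using z n a by (intro powr_mono2) auto
      also have "\<dots> = c powr (- a) * z powr a" using z assms by (simp add: powr_divide powr_minus_divide)
      finally have "2 * s * real n powr a \<le> 2 * s * (c powr (- a) * z powr a)" using s by simp
      then have KC: "K \<le> C1 * z powr a" using K by (simp add: C1_def mult_ac)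
      have "1 \<le> Gamma K" using Gamma_real_strict_mono[of 2 K] Gamma_fact[of 1, where ?'a=real] K
        by (cases "K = 2") auto
      then have "a * real n powr (K * a) / Gamma K \<le> 1 * real n powr (K * a) / 1"
        using a by (intro frac_le mult_right_mono) auto
      moreover have "kingman_const a n (k n) \<le> a * real n powr (K * a) / Gamma K"
        unfolding K_def using elim a by (intro kingman_const_le) auto
      ultimately have kc: "kingman_const a n (k n) \<le> exp (K * a * ln (real n))"
        using n by (simp add: powr_def)
      have "t powr (- ((K - 1) * a)) = z powr ((1 - a) * (K - 1))"
        using a by (simp add: z_def powr_powr mult.commute)
      also have "\<dots> \<le> z powr K"
      proof -
        have "(1 - a) * (K - 1) \<le> 1 * (K - 1)" using K a by (intro mult_right_mono) auto
        then show ?thesis using z by (intro powr_mono) auto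
      qed
      also have "\<dots> = exp (K * ln z)" using z by (simp add: powr_def)
      finally have tp: "t powr (- ((K - 1) * a)) \<le> exp (K * ln z)" .
      have "0 \<le> kingman_const a n (k n)" using kingman_const_pos(2)[OF a] elim by (auto intro: less_imp_le)
      then have "C * kingman_const a n (k n) * t powr (- ((K - 1) * a)) * exp (- z)
        \<le> C * exp (K * a * ln (real n)) * exp (K * ln z) * exp (- z)"
        using kc tp assms by (intro mult_mono) auto
      also have "\<dots> = C * exp (K * (a * ln (real n)) + K * ln z - z)"
        by (simp add: exp_add exp_diff exp_minus field_simps)
      also have "\<dots> \<le> B z"
      proof -
        have "K * (a * ln (real n)) \<le> (C1 * z powr a) * (a * ln (z / c))"
          using KC z n a C1 by (intro mult_mono) (auto intro!: mult_left_mono)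
        moreover have "K * ln z \<le> (C1 * z powr a) * ln z"
          using KC z by (intro mult_right_mono) auto
        ultimately show ?thesis using assms by (simp add: B_def mult_ac)
      qed
      also have "\<dots> \<le> \<delta>" using z0[of z] z by simp
      finally show "C * kingman_const a n (k n) * t powr (- ((real (k n) - 1) * a)) *
          exp (- (t powr (- (a / (1 - a))))) \<le> \<delta>"
        by (simp add: K_def z_def)
    qed
  qed
qed

end

section \<open>Concentration of the mixing kernel\<close>

context stable_law
begin

text \<open>The factor of \<open>h\<close> in the weight \<open>V\<^sub>n\<^sub>,\<^sub>k\<close>, divided by the claimed asymptotics
  \<open>\<alpha>\<^sup>k\<^sup>-\<^sup>1 \<Gamma>(k) / \<Gamma>(n)\<close>; compare \<open>PK_weight_eq\<close> below.\<close>

definition kingman_kernel :: "nat \<Rightarrow> nat \<Rightarrow> real \<Rightarrow> ennreal" where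
  "kingman_kernel n k t =
     ennreal (kingman_const a n k * t powr (- real n)) * frac_int (real n - real k * a) t"

lemma kingman_kernel_measurable [measurable]: "kingman_kernel n k \<in> borel_measurable borel"
  unfolding kingman_kernel_def by measurable

lemma kingman_kernel_nonpos: "t \<le> 0 \<Longrightarrow> kingman_kernel n k t = 0"
  by (simp add: kingman_kernel_def frac_int_nonpos)

text \<open>\<open>nn_integral_frac_int\<close> with \<open>b = n - k * a\<close> and
  \<open>c = k\<close> yields the reciprocal of \<open>kingman_const a n k\<close>.\<close>

lemma nn_integral_kingman_kernel:
  assumes "1 \<le> k" "k \<le> n"
  shows "(\<integral>\<^sup>+t. kingman_kernel n k t \<partial>lborel) = 1"
proof -
  define b where "b = real n - real k * a"
  note kc = kingman_const_pos[OF a assms]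
  have b: "0 < b" "b + a * real k = real n" using kc by (auto simp: b_def)
  have "0 < Gamma (real n)" "0 < Gamma (real k)" "0 < Gamma b"
    using assms b by (auto intro!: Gamma_real_pos)
  then have G: "Gamma (real n) \<noteq> 0" "Gamma (real k) \<noteq> 0" "Gamma b \<noteq> 0" by linarith+
  have "(\<integral>\<^sup>+t. kingman_kernel n k t \<partial>lborel)
      = ennreal (kingman_const a n k) * (\<integral>\<^sup>+t. ennreal (t powr (- (b + a * real k))) * frac_int b t \<partial>lborel)"
    unfolding kingman_kernel_def using kc b
    by (subst nn_integral_cmult [symmetric])
       (auto intro!: nn_integral_cong simp: ennreal_mult mult.assoc b_def)
  also have "\<dots> = ennreal (kingman_const a n k) * ennreal (Gamma b * Gamma (real k) / (a * Gamma (real n)))"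
    using b assms by (subst nn_integral_frac_int) auto
  also have "\<dots> = ennreal (kingman_const a n k * (Gamma b * Gamma (real k) / (a * Gamma (real n))))"
    using kc by (intro ennreal_mult'[symmetric]) simp
  also have "kingman_const a n k * (Gamma b * Gamma (real k) / (a * Gamma (real n))) = 1"
    using G a by (simp add: kingman_const_def b_def)
  finally show ?thesis by simp
qed

text \<open>\<open>density_ge\<close> and \<open>distribution_ge\<close> combined and solved for 1:
  multiplying an upper bound of the kernel by the right-hand side brings in the factor
  \<open>f t\<close>. The null set is the same for all \<open>l\<close>.\<close>

lemma density_ge':
  "AE t in lborel. 0 < t \<longrightarrow> (\<forall>l>0. l powr a + ln 2 \<le> l * t \<longrightarrow>
     1 \<le> 2 * Gamma (1 - a) / a * t powr (a + 1) * exp (l powr a) * f t)"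
  using density_ge
proof eventually_elim
  case (elim t)
  show ?case
  proof (intro allI impI)
    fix l assume t: "0 < t" and l: "0 < l" "l powr a + ln 2 \<le> l * t"
    have G: "0 < Gamma (1 - a)" using a by (intro Gamma_real_pos) simp
    define D where "D = a / Gamma (1 - a) * t powr (- a)"
    have D: "0 < D" using G a t by (simp add: D_def)
    have "ennreal (D * (exp (- (l powr a)) / 2)) = ennreal D * ennreal (exp (- (l powr a)) / 2)"
      using D by (intro ennreal_mult) auto
    also have "\<dots> \<le> ennreal D * frac_int 1 t"
      by (intro mult_left_mono distribution_ge l) simp
    also have "\<dots> \<le> ennreal (t * f t)" using elim t by (simp add: D_def)
    finally have "D * (exp (- (l powr a)) / 2) \<le> t * f t"
      using t f_nonneg by (simp add: ennreal_le_iff)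
    then have "2 * exp (l powr a) / D * (D * (exp (- (l powr a)) / 2)) \<le> 2 * exp (l powr a) / D * (t * f t)"
      using D by (intro mult_left_mono) auto
    moreover have "2 * exp (l powr a) / D * (D * (exp (- (l powr a)) / 2)) = 1"
      using D by (simp add: exp_minus)
    moreover have "2 * exp (l powr a) / D * (t * f t)
        = 2 * Gamma (1 - a) / a * t powr (a + 1) * exp (l powr a) * f t"
      using t by (simp add: D_def powr_minus powr_add field_simps)
    ultimately show "1 \<le> 2 * Gamma (1 - a) / a * t powr (a + 1) * exp (l powr a) * f t" by simp
  qed
qed

text \<open>Tilting by \<open>\<eta> m / t\<close> with small \<open>\<eta>\<close> in the lower bound for \<open>f\<close> costs only the fraction \<open>\<eta> powr \<alpha>\<close> of
  the exponent \<open>(m / t) powr \<alpha>\<close> gained in the upper bound for the kernel.\<close>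

lemma kingman_kernel_le_bulk:
  "AE t in lborel. \<forall>n k \<eta>. 0 < t \<longrightarrow> 1 \<le> k \<longrightarrow> k \<le> n \<longrightarrow> 0 < \<eta> \<longrightarrow> 0 < real n - 1 - real k * a \<longrightarrow>
     (\<eta> * (real n - 1 - real k * a) / t) powr a + ln 2 \<le> \<eta> * (real n - 1 - real k * a) \<longrightarrow>
     kingman_kernel n k t \<le> ennreal (2 * Gamma (1 - a) / a * (kingman_const a n k * t powr (- ((real k - 1) * a)) *
       exp (- (((real n - 1 - real k * a) / t) powr a - (\<eta> * (real n - 1 - real k * a) / t) powr a)))) * ennreal (f t)"
  using density_ge'
proof eventually_elim
  case (elim t)
  show ?case
  proof (intro allI impI)
    fix n k \<eta>
    define m where "m = real n - 1 - real k * a"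
    define l where "l = \<eta> * m / t"
    define C where "C = 2 * Gamma (1 - a) / a"
    assume t: "0 < t" and k: "1 \<le> k" "k \<le> n" and \<eta>: "0 < \<eta>" and "0 < real n - 1 - real k * a"
      and "(\<eta> * (real n - 1 - real k * a) / t) powr a + ln 2 \<le> \<eta> * (real n - 1 - real k * a)"
    then have m: "0 < m" and l: "0 < l" "l powr a + ln 2 \<le> l * t"
      by (simp_all add: m_def l_def)
    have one: "1 \<le> C * t powr (a + 1) * exp (l powr a) * f t" using elim t l by (simp add: C_def)
    have kc: "0 < kingman_const a n k" using kingman_const_pos[OF a k] by simp
    have "kingman_kernel n k t \<le> ennreal (kingman_const a n k * t powr (- real n)) *
        ennreal (t powr m * exp (- ((m / t) powr a)))"
      unfolding kingman_kernel_def using frac_int_le[of m t] m t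
      by (intro mult_left_mono) (simp_all add: m_def)
    also have "\<dots> = ennreal (kingman_const a n k * t powr (- real n) * (t powr m * exp (- ((m / t) powr a))))"
      using kc by (simp add: ennreal_mult)
    also have "\<dots> \<le> ennreal (kingman_const a n k * t powr (- real n) * (t powr m * exp (- ((m / t) powr a)))
        * (C * t powr (a + 1) * exp (l powr a) * f t))"
      using mult_left_mono[OF one, of "kingman_const a n k * t powr (- real n) * (t powr m * exp (- ((m / t) powr a)))"] kc
      by (intro ennreal_leI) simp
    also have "kingman_const a n k * t powr (- real n) * (t powr m * exp (- ((m / t) powr a)))
        * (C * t powr (a + 1) * exp (l powr a) * f t)
      = C * (kingman_const a n k * (t powr (- real n) * t powr m * t powr (a + 1)) *
          (exp (- ((m / t) powr a)) * exp (l powr a))) * f t"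
      by (simp add: mult_ac)
    also have "t powr (- real n) * t powr m * t powr (a + 1) = t powr (- ((real k - 1) * a))"
      by (simp add: m_def algebra_simps flip: powr_add)
    also have "exp (- ((m / t) powr a)) * exp (l powr a) = exp (- ((m / t) powr a - l powr a))"
      by (simp flip: exp_add)
    finally show "kingman_kernel n k t \<le> ennreal (2 * Gamma (1 - a) / a * (kingman_const a n k * t powr (- ((real k - 1) * a)) *
       exp (- (((real n - 1 - real k * a) / t) powr a - (\<eta> * (real n - 1 - real k * a) / t) powr a)))) * ennreal (f t)"
      by (simp only: ennreal_mult''[OF f_nonneg] C_def m_def l_def)
  qed
qed

text \<open>The fractional integral is cut at \<open>u = \<theta> t\<close>.  On the right part a geometric factor is gained over the
  fractional integral of order \<open>k (1 - \<alpha>)\<close>; on the left part the lower tail of \<open>f\<close> at \<open>\<theta> t\<close> beats the one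
  at \<open>t\<close> once \<open>\<theta>\<close> is small.\<close>

lemma kingman_kernel_le_small_time:
  obtains \<theta> where "0 < \<theta>" "\<theta> < 1"
    "AE t in lborel. \<forall>n k. 0 < t \<longrightarrow> 1 \<le> k \<longrightarrow> k \<le> n \<longrightarrow> 0 \<le> real n - 1 - real k * a \<longrightarrow>
      1 \<le> t powr (- (a / (1 - a))) \<longrightarrow>
      kingman_kernel n k t \<le> ennreal (kingman_const a n k * ((1 - \<theta>) powr (real n - real k) *
          (Gamma (real k * (1 - a)) / a ^ k))
        + 2 * Gamma (1 - a) / a * kingman_const a n k * t powr (- ((real k - 1) * a)) *
            exp (- (t powr (- (a / (1 - a)))))) * ennreal (f t)"
proof -
  define a' where "a' = a / (1 - a)"
  have a': "0 < a'" "1 / (1 - a) * a = a'" using a by (simp_all add: a'_def)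
  \<comment> \<open>\<open>B\<close> and \<open>\<theta>\<close> are tuned so that, with
    \<open>z = t powr (- a')\<close>, the Chernoff exponent at \<open>\<theta> * t\<close> is
    \<open>B * z / 2 = (2 powr a' + 1) * z\<close>. It exceeds by \<open>z\<close> the exponent
    \<open>2 powr a' * z\<close> lost in the lower bound of \<open>f t\<close>.\<close>
  define B where "B = 2 * (2 powr a' + 1)"
  have B: "1 < B" using a' by (simp add: B_def add_pos_pos)
  define \<theta> where "\<theta> = B powr (- 1 / a') / 2"
  have "B powr (- 1 / a') < 1" using powr_less_mono[of "- 1 / a'" 0 B] B a' by simp
  then have \<theta>: "0 < \<theta>" "\<theta> < 1" using B by (auto simp: \<theta>_def)
  have \<theta>B: "(2 * \<theta>) powr (- a') = B" using a' B by (simp add: \<theta>_def powr_powr)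
  \<comment> \<open>This \<open>l\<close> solves \<open>l powr (1 - a) = 1 / (c * x)\<close>. With
    \<open>c = 1 / 2\<close> at \<open>t\<close> it gives \<open>l * t = 2 * l powr a\<close>, so
    the condition of the lower bound becomes \<open>ln 2 \<le> l powr a\<close>; with
    \<open>c = 2\<close> at \<open>\<theta> * t\<close> half of \<open>l powr a\<close> survives in
    the Chernoff bound.\<close>
  have solve: "l * x = l powr a / c" "l powr a = (c * x) powr (- a')" "0 < l"
    if l: "l = (c * x) powr (- 1 / (1 - a))" and cx: "0 < c" "0 < x" for l c x
  proof -
    have e: "(- 1 / (1 - a)) * (1 - a) = - 1" using a by simp
    have "l powr (1 - a) = (c * x) powr (- 1)" unfolding l powr_powr e ..
    moreover have l0: "0 < l" using l cx by simp
    ultimately have "l = l powr a * (c * x) powr (- 1)" by (metis diff_add_cancel add.commute powr_add powr_one less_imp_le)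
    then show "l * x = l powr a / c" using cx by (simp add: powr_minus field_simps)
    show "l powr a = (c * x) powr (- a')" unfolding l powr_powr by (simp add: a'_def)
    show "0 < l" by (fact l0)
  qed
  have "AE t in lborel. \<forall>n k. 0 < t \<longrightarrow> 1 \<le> k \<longrightarrow> k \<le> n \<longrightarrow> 0 \<le> real n - 1 - real k * a \<longrightarrow>
      1 \<le> t powr (- a') \<longrightarrow>
      kingman_kernel n k t \<le> ennreal (kingman_const a n k * ((1 - \<theta>) powr (real n - real k) *
          (Gamma (real k * (1 - a)) / a ^ k))
        + 2 * Gamma (1 - a) / a * kingman_const a n k * t powr (- ((real k - 1) * a)) *
            exp (- (t powr (- a')))) * ennreal (f t)"
    using density_ge' frac_int_iterate
  proof eventually_elim
    case (elim t)
    show ?case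
    proof (intro allI impI)
      fix n k
      define m where "m = real n - 1 - real k * a"
      define N where "N = real n - real k"
      define b where "b = real k * (1 - a)"
      define z where "z = t powr (- a')"
      define C where "C = 2 * Gamma (1 - a) / a"
      define A where "A = kingman_const a n k"
      assume t: "0 < t" and k: "1 \<le> k" "k \<le> n" and "0 \<le> real n - 1 - real k * a" and "1 \<le> t powr (- a')"
      then have m: "0 \<le> m" and z: "1 \<le> z" by (simp_all add: m_def z_def)
      have A: "0 < A" using kingman_const_pos[OF a k] by (simp add: A_def)
      have N: "0 \<le> N" "1 \<le> N + b" "N + b = real n - real k * a" "N + b - 1 = m"
        using k m by (auto simp: N_def b_def m_def algebra_simps)
      have Gb: "0 < Gamma b" using k a by (auto simp: b_def intro!: Gamma_real_pos)

      define l where "l = (1 / 2 * t) powr (- 1 / (1 - a))"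
      have l: "l * t = 2 * l powr a" "l powr a = (1 / 2 * t) powr (- a')" "0 < l"
        using solve[OF l_def] t by simp_all
      have la: "l powr a = 2 powr a' * z" using t by (simp add: l z_def powr_mult powr_divide powr_minus_divide)
      have "1 \<le> 2 powr a'" using a' by (simp add: ge_one_powr_ge_zero)
      then have "1 * 1 \<le> 2 powr a' * z" using z by (intro mult_mono) auto
      then have "ln 2 \<le> l powr a" using ln_le_minus_one[of "2::real"] la by simp
      then have "1 \<le> C * t powr (a + 1) * exp (l powr a) * f t"
        unfolding C_def using l(1) by (intro elim(1)[rule_format] t l(3)) linarith
      then have one: "1 \<le> C * t powr (a + 1) * exp (2 powr a' * z) * f t"
        by (simp only: la)

      define l' where "l' = (2 * (\<theta> * t)) powr (- 1 / (1 - a))"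
      have l': "l' * (\<theta> * t) = l' powr a / 2" "l' powr a = (2 * (\<theta> * t)) powr (- a')" "0 < l'"
        using solve[OF l'_def] t \<theta> by simp_all
      have lB: "l' powr a = B * z"
        unfolding l'(2) mult.assoc[symmetric] using t \<theta> by (simp add: powr_mult z_def flip: \<theta>B)
      have "l' * (\<theta> * t) - l' powr a = - (2 powr a' * z) - z"
        unfolding l'(1) lB B_def by (simp add: field_simps)
      then have F: "frac_int 1 (\<theta> * t) \<le> ennreal (exp (- (2 powr a' * z) - z))"
        using distribution_le[of l' "\<theta> * t"] l'(3) by simp

      have it: "ennreal (a ^ k / Gamma b) * frac_int b t \<le> ennreal (t ^ k * f t)"
        using elim(2) k by (simp add: b_def)
      have "frac_int b t = ennreal (Gamma b / a ^ k) * (ennreal (a ^ k / Gamma b) * frac_int b t)"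
        using Gb a by (simp add: mult.assoc[symmetric] less_imp_neq[OF Gb, symmetric] flip: ennreal_mult)
      also have "\<dots> \<le> ennreal (Gamma b / a ^ k) * ennreal (t ^ k * f t)"
        by (intro mult_left_mono it) simp
      also have "\<dots> = ennreal (Gamma b / a ^ k * (t powr real k * f t))"
        using Gb a t f_nonneg by (simp add: powr_realpow flip: ennreal_mult)
      finally have fb: "frac_int b t \<le> ennreal (Gamma b / a ^ k * (t powr real k * f t))" .

      have part1: "ennreal (A * t powr (- real n)) * (ennreal (((1 - \<theta>) * t) powr N) * frac_int b t)
          \<le> ennreal (A * ((1 - \<theta>) powr N * (Gamma b / a ^ k)) * f t)"
      proof -
        have "ennreal (A * t powr (- real n)) * (ennreal (((1 - \<theta>) * t) powr N) * frac_int b t)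
          \<le> ennreal (A * t powr (- real n)) * (ennreal (((1 - \<theta>) * t) powr N) *
              ennreal (Gamma b / a ^ k * (t powr real k * f t)))"
          by (intro mult_left_mono fb) auto
        also have "\<dots> = ennreal (A * t powr (- real n) * (((1 - \<theta>) * t) powr N *
              (Gamma b / a ^ k * (t powr real k * f t))))"
          using A Gb a f_nonneg by (simp flip: ennreal_mult)
        also have "A * t powr (- real n) * (((1 - \<theta>) * t) powr N * (Gamma b / a ^ k * (t powr real k * f t)))
          = A * ((1 - \<theta>) powr N * (Gamma b / a ^ k)) * f t * (t powr (- real n) * t powr N * t powr real k)"
          using \<theta> t by (simp add: powr_mult mult_ac)
        \<comment> \<open>All powers of \<open>t\<close> cancel; this is what the order
          \<open>k * (1 - a)\<close> in the comparison achieves.\<close>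
        also have "t powr (- real n) * t powr N * t powr real k = 1"
          using t by (simp add: N_def flip: powr_add)
        finally show ?thesis by simp
      qed

      have part2: "ennreal (A * t powr (- real n)) * (ennreal (t powr m) * frac_int 1 (\<theta> * t))
          \<le> ennreal (C * A * t powr (- ((real k - 1) * a)) * exp (- z) * f t)"
      proof -
        have "ennreal (A * t powr (- real n)) * (ennreal (t powr m) * frac_int 1 (\<theta> * t))
          \<le> ennreal (A * t powr (- real n)) * (ennreal (t powr m) * ennreal (exp (- (2 powr a' * z) - z)))"
          by (intro mult_left_mono F) auto
        also have "\<dots> = ennreal (A * t powr (- real n) * (t powr m * exp (- (2 powr a' * z) - z)))"
          using A by (simp flip: ennreal_mult)
        also have "\<dots> \<le> ennreal (A * t powr (- real n) * (t powr m * exp (- (2 powr a' * z) - z))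
            * (C * t powr (a + 1) * exp (2 powr a' * z) * f t))"
          using mult_left_mono[OF one, of "A * t powr (- real n) * (t powr m * exp (- (2 powr a' * z) - z))"] A
          by (intro ennreal_leI) simp
        also have "A * t powr (- real n) * (t powr m * exp (- (2 powr a' * z) - z))
            * (C * t powr (a + 1) * exp (2 powr a' * z) * f t)
          = C * A * (t powr (- real n) * t powr m * t powr (a + 1)) *
              (exp (- (2 powr a' * z) - z) * exp (2 powr a' * z)) * f t"
          by (simp add: mult_ac)
        also have "t powr (- real n) * t powr m * t powr (a + 1) = t powr (- ((real k - 1) * a))"
          by (simp add: m_def algebra_simps flip: powr_add)
        also have "exp (- (2 powr a' * z) - z) * exp (2 powr a' * z) = exp (- z)"
          by (simp flip: exp_add)
        finally show ?thesis .
      qed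

      have "kingman_kernel n k t \<le> ennreal (A * t powr (- real n)) *
          (ennreal (((1 - \<theta>) * t) powr N) * frac_int b t + ennreal (t powr m) * frac_int 1 (\<theta> * t))"
        unfolding kingman_kernel_def A_def[symmetric]
        using frac_int_split[OF t \<theta> N(1,2)] unfolding N(4) unfolding N(3) by (rule mult_left_mono) simp
      also have "\<dots> \<le> ennreal (A * ((1 - \<theta>) powr N * (Gamma b / a ^ k)) * f t)
          + ennreal (C * A * t powr (- ((real k - 1) * a)) * exp (- z) * f t)"
        unfolding distrib_left by (intro add_mono part1 part2)
      also have "\<dots> = ennreal (A * ((1 - \<theta>) powr N * (Gamma b / a ^ k))
          + C * A * t powr (- ((real k - 1) * a)) * exp (- z)) * ennreal (f t)"
      proof -
        have "0 \<le> C" using a by (auto simp: C_def intro!: divide_nonneg_nonneg mult_nonneg_nonneg less_imp_le[OF Gamma_real_pos])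
        then show ?thesis
          using A Gb a f_nonneg by (simp add: distrib_right flip: ennreal_plus ennreal_mult)
      qed
      finally show "kingman_kernel n k t \<le> ennreal (kingman_const a n k * ((1 - \<theta>) powr (real n - real k) *
          (Gamma (real k * (1 - a)) / a ^ k))
        + 2 * Gamma (1 - a) / a * kingman_const a n k * t powr (- ((real k - 1) * a)) *
            exp (- (t powr (- a')))) * ennreal (f t)"
        by (simp only: A_def N_def b_def C_def z_def)
    qed
  qed
  with \<theta> show ?thesis using that unfolding a'_def by blast
qed

text \<open>Substitution \<open>u = (1 - p) * t\<close>. Should the integral diverge, both sides are
  0 by convention.\<close>

lemma stick_integral:
  assumes "0 < t" "0 < b"
  shows "(LBINT p:{0<..<1}. p powr (b - 1) * f ((1 - p) * t)) = t powr (- b) * enn2real (frac_int b t)"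
proof -
  define X where "X = (\<integral>\<^sup>+p. ennreal (indicator {0<..<1} p * (p powr (b - 1) * f ((1 - p) * t))) \<partial>lborel)"
  have "frac_int b t = ennreal t * (\<integral>\<^sup>+p. ennreal ((t - (t + - t * p)) powr (b - 1) * f (t + - t * p))
      * indicator {..<t} (t + - t * p) \<partial>lborel)"
    unfolding frac_int_def using assms by (subst nn_integral_real_affine[where c="- t" and t=t]) auto
  also have "\<dots> = ennreal t * (\<integral>\<^sup>+p. ennreal (t powr (b - 1)) *
      ennreal (indicator {0<..<1} p * (p powr (b - 1) * f ((1 - p) * t))) \<partial>lborel)"
  proof (intro arg_cong[where f="(*) (ennreal t)"] nn_integral_cong)
    fix p :: real
    have p: "t + - t * p = (1 - p) * t" "t - (t + - t * p) = t * p" by (simp_all add: algebra_simps)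
    have i: "(1 - p) * t < t \<longleftrightarrow> 0 < p" using assms by (simp add: algebra_simps zero_less_mult_iff)
    have f0: "f ((1 - p) * t) = 0" if "1 \<le> p"
      using that assms by (intro f_supp) (simp add: mult_nonpos_nonneg)
    show "ennreal ((t - (t + - t * p)) powr (b - 1) * f (t + - t * p)) * indicator {..<t} (t + - t * p)
      = ennreal (t powr (b - 1)) * ennreal (indicator {0<..<1} p * (p powr (b - 1) * f ((1 - p) * t)))"
      unfolding p(2) unfolding p(1) using assms f_nonneg f0 i
      by (cases "p < 1") (auto simp: indicator_def powr_mult mult.assoc not_less simp flip: ennreal_mult)
  qed
  also have "\<dots> = ennreal t * (ennreal (t powr (b - 1)) * X)"
    unfolding X_def by (subst nn_integral_cmult) auto
  also have "\<dots> = ennreal (t powr b) * X"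
  proof -
    have "t * t powr (b - 1) = t powr b" using assms by (simp add: powr_diff)
    then show ?thesis using assms by (simp add: mult.assoc[symmetric] flip: ennreal_mult)
  qed
  finally have "enn2real (frac_int b t) = t powr b * enn2real X" by (simp add: enn2real_mult)
  moreover have "(LBINT p:{0<..<1}. p powr (b - 1) * f ((1 - p) * t)) = enn2real X"
    unfolding set_lebesgue_integral_def X_def real_scaleR_def
    using f_nonneg by (intro integral_eq_nn_integral) auto
  ultimately show ?thesis using assms by (simp add: powr_minus field_simps)
qed

end

locale kingman_asymptotics = stable_law + block_count_asymptotics
begin

text \<open>Two regimes, separated by the condition \<open>(q / t) powr a + ln 2 \<le> q\<close>
  with \<open>q = \<eta> * stick_exponent n\<close>. If it holds, the tilted lower bound for
  \<open>f\<close> is available and the bulk estimate applies; if not, the two terms of the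
  small-time bound contribute at most \<open>\<delta> / 2\<close> each.\<close>

lemma kernel_far_eventually:
  assumes "0 < \<epsilon>" "0 < \<delta>"
  shows "\<forall>\<^sub>F n in sequentially. AE t in lborel. 0 < t \<longrightarrow> \<epsilon> \<le> \<bar>t - s powr (- 1 / a)\<bar> \<longrightarrow>
    kingman_kernel n (k n) t \<le> ennreal \<delta> * ennreal (f t)"
proof -
  define C where "C = 2 * Gamma (1 - a) / a"
  have "0 < Gamma (1 - a)" using a by (intro Gamma_real_pos) simp
  then have C: "0 < C" using a by (simp add: C_def)
  obtain \<eta> where \<eta>: "0 < \<eta>" and bulk: "\<forall>\<^sub>F n in sequentially. \<forall>t>0. \<epsilon> \<le> \<bar>t - s powr (- 1 / a)\<bar> \<longrightarrow>
      kingman_const a n (k n) * t powr (- ((real (k n) - 1) * a)) *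
        exp (- ((stick_exponent n / t) powr a - (\<eta> * stick_exponent n / t) powr a)) \<le> \<delta> / C"
    using bulk_eventually[of \<epsilon> "\<delta> / C"] assms C by auto
  obtain \<theta> where \<theta>: "0 < \<theta>" "\<theta> < 1" and small: "AE t in lborel. \<forall>n k. 0 < t \<longrightarrow> 1 \<le> k \<longrightarrow> k \<le> n \<longrightarrow> 0 \<le> real n - 1 - real k * a \<longrightarrow>
      1 \<le> t powr (- (a / (1 - a))) \<longrightarrow>
      kingman_kernel n k t \<le> ennreal (kingman_const a n k * ((1 - \<theta>) powr (real n - real k) *
          (Gamma (real k * (1 - a)) / a ^ k))
        + C * kingman_const a n k * t powr (- ((real k - 1) * a)) *
            exp (- (t powr (- (a / (1 - a)))))) * ennreal (f t)"
    using kingman_kernel_le_small_time unfolding C_def by blast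
  \<comment> \<open>If the bulk condition fails and \<open>2 * ln 2 \<le> q\<close>, then
    \<open>q / 2 \<le> (q / t) powr a\<close>, that is,
    \<open>q * (1 / 2) powr (1 / (1 - a))\<close> is at most
    \<open>t powr (- (a / (1 - a)))\<close>. Inserting \<open>\<eta> / 2 * n \<le> q\<close> gives
    the lower bound \<open>c * n\<close>.\<close>
  define c where "c = \<eta> / 2 * (1 / 2) powr (1 / (1 - a))"
  have c: "0 < c" using \<eta> by (simp add: c_def)
  have e1: "\<forall>\<^sub>F n in sequentially. 4 * ln 2 \<le> \<eta> * real n" using \<eta> by real_asymp
  have e2: "\<forall>\<^sub>F n in sequentially. 1 \<le> c * real n" using c by real_asymp
  have "0 < \<delta> / 2" using assms by simp
  note geo = geometric_part_eventually[OF \<theta> this] and st = small_time_eventually[OF c C this]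
  show ?thesis using bulk geo st e1 e2 k_bounds stick_exponent_bounds
  proof eventually_elim
    case (elim n)
    have k: "1 \<le> k n" "k n \<le> n" using elim by auto
    have m: "0 < stick_exponent n" "real n / 2 \<le> stick_exponent n" using elim by auto
    define q where "q = \<eta> * stick_exponent n"
    have "\<eta> / 2 * real n \<le> q" using mult_left_mono[OF m(2), of \<eta>] \<eta> by (simp add: q_def)
    moreover have "0 < q" using \<eta> m(1) by (simp add: q_def)
    ultimately have q: "2 * ln 2 \<le> q" "\<eta> / 2 * real n \<le> q" "0 < q"
      using \<open>4 * ln 2 \<le> \<eta> * real n\<close> by simp_all
    show "AE t in lborel. 0 < t \<longrightarrow> \<epsilon> \<le> \<bar>t - s powr (- 1 / a)\<bar> \<longrightarrow>
        kingman_kernel n (k n) t \<le> ennreal \<delta> * ennreal (f t)"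
      using kingman_kernel_le_bulk small
    proof eventually_elim
      case (elim t)
      show ?case
      proof (intro impI)
        assume t: "0 < t" and far: "\<epsilon> \<le> \<bar>t - s powr (- 1 / a)\<bar>"
        show "kingman_kernel n (k n) t \<le> ennreal \<delta> * ennreal (f t)"
        proof (cases "(q / t) powr a + ln 2 \<le> q")
          case True
          have "kingman_kernel n (k n) t \<le> ennreal (C * (kingman_const a n (k n) * t powr (- ((real (k n) - 1) * a)) *
              exp (- ((stick_exponent n / t) powr a - (\<eta> * stick_exponent n / t) powr a)))) * ennreal (f t)"
            using elim(1)[rule_format, OF t k \<eta>] m True by (simp add: C_def stick_exponent_def q_def)
          also have "\<dots> \<le> ennreal (C * (\<delta> / C)) * ennreal (f t)"
            using \<open>\<forall>t>0. \<epsilon> \<le> \<bar>t - s powr (- 1 / a)\<bar> \<longrightarrow> _ t \<le> \<delta> / C\<close> t far C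
            by (intro mult_right_mono ennreal_leI mult_left_mono) auto
          finally show ?thesis using C by simp
        next
          case False
          \<comment> \<open>then \<open>t\<close> is so small that \<open>z\<close> is at least of order \<open>n\<close>\<close>
          define z where "z = t powr (- (a / (1 - a)))"
          have "q / 2 \<le> (q / t) powr a" using False q by linarith
          also have "\<dots> = q powr a * t powr (- a)" using q t by (simp add: powr_divide powr_minus_divide)
          finally have "q powr (- a) * (q / 2) \<le> q powr (- a) * (q powr a * t powr (- a))"
            by (rule mult_left_mono) simp
          then have "q powr (1 - a) * (1 / 2) \<le> t powr (- a)"
            using q by (simp add: powr_diff powr_minus field_simps)
          then have "(q powr (1 - a) * (1 / 2)) powr (1 / (1 - a)) \<le> (t powr (- a)) powr (1 / (1 - a))"
            using q a by (intro powr_mono2) auto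
          moreover have "(q powr (1 - a) * (1 / 2)) powr (1 / (1 - a)) = q * (1 / 2) powr (1 / (1 - a))"
            using q a by (subst powr_mult) (auto simp: powr_powr)
          moreover have "(t powr (- a)) powr (1 / (1 - a)) = z" by (simp add: powr_powr z_def)
          ultimately have "q * (1 / 2) powr (1 / (1 - a)) \<le> z" by simp
          moreover have "c * real n \<le> q * (1 / 2) powr (1 / (1 - a))"
            using mult_right_mono[OF q(2), of "(1 / 2) powr (1 / (1 - a))"] by (simp add: c_def mult_ac)
          ultimately have z: "c * real n \<le> z" by linarith
          then have z1: "1 \<le> z" using \<open>1 \<le> c * real n\<close> by linarith
          have "kingman_kernel n (k n) t \<le> ennreal (kingman_const a n (k n) * ((1 - \<theta>) powr (real n - real (k n)) *
              (Gamma (real (k n) * (1 - a)) / a ^ k n))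
            + C * kingman_const a n (k n) * t powr (- ((real (k n) - 1) * a)) * exp (- z)) * ennreal (f t)"
            using elim(2)[rule_format, OF t k] m z1 by (simp add: stick_exponent_def z_def)
          also have "\<dots> \<le> ennreal (\<delta> / 2 + \<delta> / 2) * ennreal (f t)"
            using \<open>kingman_const a n (k n) * ((1 - \<theta>) powr (real n - real (k n)) * _) \<le> \<delta> / 2\<close>
              \<open>\<forall>t>0. c * real n \<le> t powr _ \<longrightarrow> _ t \<le> \<delta> / 2\<close> t z
            by (intro mult_right_mono ennreal_leI add_mono) (auto simp: z_def)
          finally show ?thesis by simp
        qed
      qed
    qed
  qed
qed

text \<open>Near \<open>t0\<close> continuity bounds the error by \<open>\<delta>\<close> times the
  kernel. Elsewhere the kernel is at most \<open>\<delta> * f\<close>, and the error at most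
  \<open>\<delta> * (h * f + h t0 * f)\<close>. Kernel and \<open>f\<close> have mass 1, so the sum
  is \<open>\<delta> * (1 + I + h t0) < r\<close>.\<close>

lemma kernel_integral_tendsto:
  assumes h [measurable]: "h \<in> borel_measurable borel" and h_nonneg: "\<And>t. 0 \<le> h t"
    and hf: "integrable lborel (\<lambda>t. h t * f t)"
    and cont: "isCont h (s powr (- 1 / a))"
  shows "(\<lambda>n. \<integral>t. enn2real (kingman_kernel n (k n) t) * h t \<partial>lborel) \<longlonglongrightarrow> h (s powr (- 1 / a))"
proof (rule LIMSEQ_I)
  fix r :: real assume r: "0 < r"
  define t0 where "t0 = s powr (- 1 / a)"
  define I where "I = (\<integral>t. h t * f t \<partial>lborel)"
  have I: "0 \<le> I" unfolding I_def using h_nonneg f_nonneg by (intro Bochner_Integration.integral_nonneg) simp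
  have f_int: "integrable lborel f" "(\<integral>t. f t \<partial>lborel) = 1"
    using total_mass f_nonneg by (auto intro!: integrableI_nonneg simp: integral_eq_nn_integral)
  define \<delta> where "\<delta> = r / (2 * (1 + I + h t0))"
  have \<delta>: "0 < \<delta>" "\<delta> * (1 + I + h t0) < r"
    using r I h_nonneg[of t0] by (auto simp: \<delta>_def field_simps intro!: add_pos_nonneg)
  obtain \<epsilon> where \<epsilon>: "0 < \<epsilon>" "\<And>t. \<bar>t - t0\<bar> < \<epsilon> \<Longrightarrow> \<bar>h t - h t0\<bar> < \<delta>"
    using cont \<delta>(1) unfolding continuous_at_eps_delta t0_def[symmetric] dist_real_def by metis
  have "\<forall>\<^sub>F n in sequentially. norm ((\<integral>t. enn2real (kingman_kernel n (k n) t) * h t \<partial>lborel) - h t0) < r"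
    using kernel_far_eventually[OF \<epsilon>(1) \<delta>(1)] k_bounds stick_exponent_bounds
  proof eventually_elim
    case (elim n)
    define W where "W t = enn2real (kingman_kernel n (k n) t)" for t
    have W_meas [measurable]: "W \<in> borel_measurable lborel" unfolding W_def by measurable
    \<comment> \<open>The kernel is finite at every \<open>t\<close>, so nothing is lost in passing
      to real values.\<close>
    have W: "ennreal (W t) = kingman_kernel n (k n) t" for t
    proof (cases "0 < t")
      case True
      have "0 \<le> stick_exponent n" using elim by auto
      then have "frac_int (real n - real (k n) * a) t < top"
        using frac_int_le[of "stick_exponent n" t] True by (auto simp: stick_exponent_def intro: le_less_trans)
      then show ?thesis
        by (auto simp: W_def kingman_kernel_def ennreal_mult_less_top intro!: ennreal_enn2real)
    qed (simp add: W_def kingman_kernel_nonpos)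
    have W0: "0 \<le> W t" for t by (simp add: W_def)
    have W_nn: "(\<integral>\<^sup>+t. ennreal (W t) \<partial>lborel) = 1"
      unfolding W using elim by (intro nn_integral_kingman_kernel) auto
    have W_int: "integrable lborel W" "(\<integral>t. W t \<partial>lborel) = 1"
      using W_nn W0 by (auto intro!: integrableI_nonneg simp: integral_eq_nn_integral)
    define G where "G t = \<delta> * W t + \<delta> * (h t * f t + h t0 * f t)" for t
    have G_int: "integrable lborel G" "(\<integral>t. G t \<partial>lborel) = \<delta> * (1 + I + h t0)"
      unfolding G_def using W_int hf f_int by (simp_all add: I_def algebra_simps)
    have le: "AE t in lborel. norm (W t * h t - W t * h t0) \<le> G t"
      using elim(1)
    proof eventually_elim
      case (elim t)
      have nn: "0 \<le> \<delta> * (h t * f t + h t0 * f t)" "0 \<le> \<delta> * W t"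
        using \<delta> h_nonneg f_nonneg W0 by simp_all
      have eq: "norm (W t * h t - W t * h t0) = W t * \<bar>h t - h t0\<bar>"
        using W0[of t] by (simp add: abs_mult flip: right_diff_distrib)
      consider "t \<le> 0" | "0 < t" "\<bar>t - t0\<bar> < \<epsilon>" | "0 < t" "\<epsilon> \<le> \<bar>t - t0\<bar>" by linarith
      then show ?case
      proof cases
        case 1
        then show ?thesis using nn by (simp add: W_def kingman_kernel_nonpos G_def)
      next
        case 2
        then have "W t * \<bar>h t - h t0\<bar> \<le> W t * \<delta>"
          using \<epsilon>(2) W0 by (intro mult_left_mono) (auto intro: less_imp_le)
        then have "W t * \<bar>h t - h t0\<bar> \<le> \<delta> * W t" by (simp only: mult.commute)
        then show ?thesis unfolding eq G_def using nn by linarith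
      next
        case 3
        then have "ennreal (W t) \<le> ennreal (\<delta> * f t)"
          using elim \<delta> f_nonneg by (simp add: W t0_def ennreal_mult)
        then have "W t \<le> \<delta> * f t" using \<delta> f_nonneg by (simp add: ennreal_le_iff)
        moreover have "\<bar>h t - h t0\<bar> \<le> h t + h t0" using h_nonneg[of t] h_nonneg[of t0] by linarith
        ultimately have "W t * \<bar>h t - h t0\<bar> \<le> \<delta> * f t * (h t + h t0)"
          using W0 \<delta> f_nonneg by (intro mult_mono) auto
        then have "W t * \<bar>h t - h t0\<bar> \<le> \<delta> * (h t * f t + h t0 * f t)"
          by (simp only: distrib_left distrib_right mult_ac)
        then show ?thesis unfolding eq G_def using nn by linarith
      qed
    qed
    \<comment> \<open>The majorant \<open>G\<close> also yields the integrability of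
      \<open>W * h\<close>, which the linearity of the integral requires.\<close>
    have d_int: "integrable lborel (\<lambda>t. W t * h t - W t * h t0)"
      by (rule Bochner_Integration.integrable_bound[OF G_int(1)])
         (use le in \<open>auto elim!: eventually_mono\<close>)
    have "integrable lborel (\<lambda>t. W t * h t - W t * h t0 + W t * h t0)"
      using d_int W_int by (intro Bochner_Integration.integrable_add) auto
    then have Wh_int: "integrable lborel (\<lambda>t. W t * h t)" by simp
    have "\<bar>(\<integral>t. W t * h t - W t * h t0 \<partial>lborel)\<bar> \<le> (\<integral>t. G t \<partial>lborel)"
      by (intro order_trans[OF integral_abs_bound] integral_mono_AE) (use d_int G_int le in auto)
    moreover have "(\<integral>t. W t * h t - W t * h t0 \<partial>lborel) = (\<integral>t. W t * h t \<partial>lborel) - h t0"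
      using Wh_int W_int by simp
    ultimately show ?case using G_int(2) \<delta>(2) by (simp add: W_def)
  qed
  then show "\<exists>no. \<forall>n\<ge>no. norm ((\<integral>t. enn2real (kingman_kernel n (k n) t) * h t \<partial>lborel) - h (s powr (- 1 / a))) < r"
    by (simp add: eventually_sequentially t0_def)
qed

end

section \<open>The asymptotics of the weights\<close>

text \<open>\<open>stable_density\<close> constrains \<open>f\<close> on the positive half-line;
  setting it to 0 elsewhere gives the version required by the locale.\<close>

lemma stable_law_restrict:
  assumes "0 < \<alpha>" "\<alpha> < 1" and f: "stable_density \<alpha> f"
  shows "stable_law \<alpha> (\<lambda>t. indicator {0<..} t * f t)"
proof
  show "(\<lambda>t. indicator {0<..} t * f t) \<in> borel_measurable borel"
    using f by (simp add: stable_density_def prob_density_on_pos_def set_borel_measurable_def)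
  show nonneg: "0 \<le> indicator {0<..} t * f t" for t :: real
    using f by (auto simp: stable_density_def prob_density_on_pos_def indicator_def)
  have meas: "(\<lambda>t. indicator {0<..} t * f t) \<in> borel_measurable borel"
    using f by (simp add: stable_density_def prob_density_on_pos_def set_borel_measurable_def)
  have int: "integrable lborel (\<lambda>t. indicator {0<..} t * f t)"
    using f by (simp add: stable_density_def prob_density_on_pos_def set_integrable_def)
  fix l :: real assume l: "0 \<le> l"
  have le: "norm (exp (- (l * t)) * (indicator {0<..} t * f t)) \<le> norm (indicator {0<..} t * f t)" for t
    using l by (auto simp: indicator_def abs_mult intro!: mult_left_le_one_le)
  have "integrable lborel (\<lambda>t. exp (- (l * t)) * (indicator {0<..} t * f t))"
    by (rule Bochner_Integration.integrable_bound[OF int]) (use le meas in auto)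
  then have "(\<integral>\<^sup>+t. ennreal (exp (- (l * t)) * (indicator {0<..} t * f t)) \<partial>lborel)
      = ennreal (\<integral>t. exp (- (l * t)) * (indicator {0<..} t * f t) \<partial>lborel)"
    using nonneg by (intro nn_integral_eq_integral) auto
  also have "(\<integral>t. exp (- (l * t)) * (indicator {0<..} t * f t) \<partial>lborel) = (LBINT t:{0<..}. exp (- (l * t)) * f t)"
    unfolding set_lebesgue_integral_def by (intro Bochner_Integration.integral_cong) auto
  also have "\<dots> = exp (- (l powr \<alpha>))" using f l by (simp add: stable_density_def)
  finally show "(\<integral>\<^sup>+t. ennreal (exp (- (l * t)) * (indicator {0<..} t * f t)) \<partial>lborel)
      = ennreal (exp (- (l powr \<alpha>)))" .
qed (use assms in auto)

text \<open>For \<open>t > 0\<close> and \<open>0 < p < 1\<close> the argument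
  \<open>(1 - p) * t\<close> is positive, so \<open>f\<close> may be replaced by its restriction.
  The substitution in the inner integral then completes \<open>t powr (- (k * \<alpha>))\<close> to
  \<open>t powr (- n)\<close>.\<close>

lemma PK_weight_eq:
  assumes "0 < \<alpha>" "\<alpha> < 1" and f: "stable_density \<alpha> f" and k: "1 \<le> k" "k \<le> n"
  shows "PK_weight \<alpha> f h n k = \<alpha> ^ (k - 1) * Gamma (real k) / Gamma (real n) *
    (\<integral>t. enn2real (stable_law.kingman_kernel \<alpha> (\<lambda>t. indicator {0<..} t * f t) n k t) *
       (indicator {0<..} t * h t) \<partial>lborel)"
proof -
  define f0 where "f0 = (\<lambda>t. indicator {0<..} t * f t)"
  interpret stable_law \<alpha> f0 unfolding f0_def by (rule stable_law_restrict[OF assms(1-3)])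
  define b where "b = real n - real k * \<alpha>"
  have kc: "0 < b" "0 < kingman_const \<alpha> n k"
    using kingman_const_pos[OF assms(1,2) k] by (simp_all add: b_def)
  have "0 < Gamma (real n)" "0 < Gamma (real k)"
    using k by (auto intro!: Gamma_real_pos)
  then have G: "Gamma (real n) \<noteq> 0" "Gamma (real k) \<noteq> 0" by linarith+
  have ak: "\<alpha> ^ k = \<alpha> ^ (k - 1) * \<alpha>" using k power_minus_mult[of k \<alpha>] by simp
  have const: "\<alpha> ^ k / Gamma b = \<alpha> ^ (k - 1) * Gamma (real k) / Gamma (real n) * kingman_const \<alpha> n k"
    unfolding ak kingman_const_def b_def[symmetric] using G by simp
  have inner: "(LBINT p:{0<..<1}. p powr (real n - 1 - real k * \<alpha>) * f ((1 - p) * t))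
      = t powr (- b) * enn2real (frac_int b t)" if t: "0 < t" for t
  proof -
    have "(LBINT p:{0<..<1}. p powr (real n - 1 - real k * \<alpha>) * f ((1 - p) * t))
        = (LBINT p:{0<..<1}. p powr (b - 1) * f0 ((1 - p) * t))"
      unfolding set_lebesgue_integral_def
      by (intro Bochner_Integration.integral_cong) (use t in \<open>auto simp: f0_def b_def indicator_def algebra_simps\<close>)
    then show ?thesis using stick_integral[OF t kc(1)] by simp
  qed
  have "PK_weight \<alpha> f h n k = (\<integral>t. \<alpha> ^ (k - 1) * Gamma (real k) / Gamma (real n) *
      (enn2real (kingman_kernel n k t) * (indicator {0<..} t * h t)) \<partial>lborel)"
    unfolding PK_weight_def set_lebesgue_integral_def[where A="{0<..}"]
  proof (intro Bochner_Integration.integral_cong refl)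
    fix t :: real
    show "indicator {0<..} t *\<^sub>R (\<alpha> ^ k / Gamma (real n - real k * \<alpha>) * t powr (- (real k * \<alpha>)) *
        (LBINT p:{0<..<1}. p powr (real n - 1 - real k * \<alpha>) * f ((1 - p) * t)) * h t)
      = \<alpha> ^ (k - 1) * Gamma (real k) / Gamma (real n) *
      (enn2real (kingman_kernel n k t) * (indicator {0<..} t * h t))"
    proof (cases "0 < t")
      case True
      have "t powr (- (real k * \<alpha>)) * t powr (- b) = t powr (- real n)"
        by (simp add: b_def flip: powr_add)
      then have "\<alpha> ^ k / Gamma b * t powr (- (real k * \<alpha>)) * (t powr (- b) * enn2real (frac_int b t)) * h t
          = \<alpha> ^ (k - 1) * Gamma (real k) / Gamma (real n) *
            (kingman_const \<alpha> n k * t powr (- real n) * enn2real (frac_int b t) * h t)"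
        unfolding const by (simp add: mult_ac)
      moreover have "enn2real (kingman_kernel n k t)
          = kingman_const \<alpha> n k * t powr (- real n) * enn2real (frac_int b t)"
        using kc by (simp add: kingman_kernel_def enn2real_mult b_def)
      ultimately show ?thesis using True by (simp add: inner b_def)
    qed simp
  qed
  then show ?thesis by (simp add: f0_def)
qed

text \<open>After cancellation of the common constant, numerator and denominator both tend to the
  value of \<open>h\<close> at \<open>s powr (- 1 / \<alpha>)\<close> by continuity there; as this
  value is positive, the quotient of the limits is 1.\<close>

theorem proposition1:
  fixes \<alpha> s :: real and f h :: "real \<Rightarrow> real" and k :: "nat \<Rightarrow> nat"
  assumes alpha: "0 < \<alpha>" "\<alpha> < 1"
    and f: "stable_density \<alpha> f"
    and h_meas: "set_borel_measurable borel {0<..} h"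
    and h_nonneg: "\<And>t. 0 < t \<Longrightarrow> 0 \<le> h t"
    and gamma: "prob_density_on_pos (\<lambda>t. h t * f t)"
    and s: "0 < s"
    and h_cont: "isCont h (s powr (- 1 / \<alpha>))"
    and h_pos: "0 < h (s powr (- 1 / \<alpha>))"
    and k_range: "\<And>n. 1 \<le> n \<Longrightarrow> 1 \<le> k n \<and> k n \<le> n"
    and k_lim: "(\<lambda>n. real (k n) / real n powr \<alpha>) \<longlonglongrightarrow> s"
  shows "(\<lambda>n. PK_weight \<alpha> f h n (k n) /
            (\<alpha> ^ (k n - 1) * Gamma (real (k n)) / Gamma (real n) *
             h ((real (k n) / real n powr \<alpha>) powr (- 1 / \<alpha>)))) \<longlonglongrightarrow> 1"
proof -
  define f0 where "f0 = (\<lambda>t. indicator {0<..} t * f t)"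
  define h0 where "h0 = (\<lambda>t. indicator {0<..} t * h t)"
  define t0 where "t0 = s powr (- 1 / \<alpha>)"
  have t0: "0 < t0" using s by (simp add: t0_def)
  interpret kingman_asymptotics \<alpha> f0 s k
    unfolding f0_def kingman_asymptotics_def block_count_asymptotics_def
    using stable_law_restrict[OF alpha f] alpha s k_range k_lim by blast
  have h0: "h0 \<in> borel_measurable borel" "\<And>t. 0 \<le> h0 t"
    using h_meas h_nonneg by (auto simp: h0_def set_borel_measurable_def indicator_def)
  have "set_integrable lborel {0<..} (\<lambda>t. h t * f t)"
    using gamma by (simp add: prob_density_on_pos_def)
  moreover have "indicator {0<..} t *\<^sub>R (h t * f t) = h0 t * f0 t" for t
    by (simp add: h0_def f0_def indicator_def)
  ultimately have hf: "integrable lborel (\<lambda>t. h0 t * f0 t)" by (simp add: set_integrable_def)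
  \<comment> \<open>Since \<open>t0 > 0\<close>, the cut-off at 0 changes nothing near
    \<open>t0\<close>, so continuity passes from \<open>h\<close> to \<open>h0\<close>.\<close>
  have "\<forall>\<^sub>F t in nhds t0. h0 t = h t"
    using eventually_nhds_in_open[of "{0<..}" t0] t0 by (auto simp: h0_def elim!: eventually_mono)
  then have "isCont h0 t0 \<longleftrightarrow> isCont h t0" by (rule isCont_cong)
  then have cont: "isCont h0 t0" using h_cont by (simp add: t0_def)
  have "(\<lambda>n. (real (k n) / real n powr \<alpha>) powr (- 1 / \<alpha>)) \<longlonglongrightarrow> t0"
    unfolding t0_def using s by (intro tendsto_intros k_lim) auto
  then have den: "(\<lambda>n. h ((real (k n) / real n powr \<alpha>) powr (- 1 / \<alpha>))) \<longlonglongrightarrow> h t0"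
    using h_cont isCont_tendsto_compose unfolding t0_def by blast
  have "(\<lambda>n. \<integral>t. enn2real (kingman_kernel n (k n) t) * h0 t \<partial>lborel) \<longlonglongrightarrow> h0 t0"
    using kernel_integral_tendsto[OF h0 hf] cont unfolding t0_def by blast
  then have "(\<lambda>n. (\<integral>t. enn2real (kingman_kernel n (k n) t) * h0 t \<partial>lborel) /
      h ((real (k n) / real n powr \<alpha>) powr (- 1 / \<alpha>))) \<longlonglongrightarrow> h0 t0 / h t0"
    using den h_pos by (intro tendsto_divide) (auto simp: t0_def)
  also have "h0 t0 / h t0 = 1" using t0 h_pos by (simp add: h0_def t0_def)
  finally show ?thesis
  proof (rule Lim_transform_eventually)
    show "\<forall>\<^sub>F n in sequentially. (\<integral>t. enn2real (kingman_kernel n (k n) t) * h0 t \<partial>lborel) /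
        h ((real (k n) / real n powr \<alpha>) powr (- 1 / \<alpha>))
      = PK_weight \<alpha> f h n (k n) / (\<alpha> ^ (k n - 1) * Gamma (real (k n)) / Gamma (real n) *
             h ((real (k n) / real n powr \<alpha>) powr (- 1 / \<alpha>)))"
      using eventually_ge_at_top[of 1]
    proof eventually_elim
      case (elim n)
      then have k: "1 \<le> k n" "k n \<le> n" using k_range by auto
      have "0 < \<alpha> ^ (k n - 1) * Gamma (real (k n)) / Gamma (real n)"
        using k elim alpha by (auto intro!: divide_pos_pos mult_pos_pos Gamma_real_pos)
      then have "\<alpha> ^ (k n - 1) * Gamma (real (k n)) / Gamma (real n) \<noteq> 0" by linarith
      then show ?case
        unfolding PK_weight_eq[OF alpha f k] f0_def[symmetric] h0_def
        by (rule nonzero_mult_divide_mult_cancel_left[symmetric])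
    qed
  qed
qed

end
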